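(* Let $H$ be Higman's group, i.e. the group with presentation $H=\langle a_i\ (i\in\mathbb Z/4\mathbb Z)\mid a_i a_{i+1} a_i^{-1}=a_{i+1}^2 \text{ for all } i\in \mathbb Z/4\mathbb Z\rangle$. Then $H$ is left-orderable, and hence $H$ admits a faithful action on the real line by homeomorphisms (i.e. an injective homomorphism $H\to\mathsf{Homeo}(\mathbb R)$).
   Context: A group $G$ is left-orderable if it admits a total order $\preceq$ such that $f\preceq g$ implies $hf\preceq hg$ for all $f,g,h\in G$. *)

theory Defs
  imports "HOL-Analysis.Analysis" "HOL-Algebra.Group" "HOL-Library.Numeral_Type"
begin

text \<open>Letters of the free group on generators a_i, i in Z/4Z (type 4 has arithmetic mod 4).
  (i, False) stands for a_i and (i, True) for a_i^{-1}.\<close>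
type_synonym hletter = "4 \<times> bool"
type_synonym hword = "hletter list"

definition inv_letter :: "hletter \<Rightarrow> hletter" where
  "inv_letter x = (fst x, \<not> snd x)"

text \<open>Relator a_i a_{i+1} a_i^{-1} a_{i+1}^{-2}, encoding a_i a_{i+1} a_i^{-1} = a_{i+1}^2.\<close>
definition higman_relator :: "4 \<Rightarrow> hword" where
  "higman_relator i = [(i, False), (i + 1, False), (i, True), (i + 1, True), (i + 1, True)]"

inductive higman_eqv :: "hword \<Rightarrow> hword \<Rightarrow> bool" where
  refl: "higman_eqv w w"
| sym: "higman_eqv v w \<Longrightarrow> higman_eqv w v"
| trans: "higman_eqv u v \<Longrightarrow> higman_eqv v w \<Longrightarrow> higman_eqv u w"
| cancel: "higman_eqv (u @ [x, inv_letter x] @ v) (u @ v)"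
| rel: "higman_eqv (u @ higman_relator i @ v) (u @ v)"

definition higman_class :: "hword \<Rightarrow> hword set" where
  "higman_class w = {v. higman_eqv w v}"

definition Higman :: "hword set monoid" where
  "Higman = \<lparr> carrier = range higman_class,
              mult = (\<lambda>X Y. {v. \<exists>x\<in>X. \<exists>y\<in>Y. higman_eqv (x @ y) v}),
              one = higman_class [] \<rparr>"

definition left_orderable :: "('a, 'b) monoid_scheme \<Rightarrow> bool" where
  "left_orderable G \<longleftrightarrow> (\<exists>le :: 'a \<Rightarrow> 'a \<Rightarrow> bool.
     (\<forall>f\<in>carrier G. le f f) \<and>
     (\<forall>f\<in>carrier G. \<forall>g\<in>carrier G. le f g \<and> le g f \<longrightarrow> f = g) \<and>
     (\<forall>f\<in>carrier G. \<forall>g\<in>carrier G. \<forall>h\<in>carrier G. le f g \<and> le g h \<longrightarrow> le f h) \<and>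
     (\<forall>f\<in>carrier G. \<forall>g\<in>carrier G. le f g \<or> le g f) \<and>
     (\<forall>f\<in>carrier G. \<forall>g\<in>carrier G. \<forall>h\<in>carrier G. le f g \<longrightarrow> le (h \<otimes>\<^bsub>G\<^esub> f) (h \<otimes>\<^bsub>G\<^esub> g)))"

definition Homeo_R :: "(real \<Rightarrow> real) monoid" where
  "Homeo_R = \<lparr> carrier = {f. \<exists>g. homeomorphism UNIV UNIV f g},
               mult = (\<circ>), one = id \<rparr>"

end

theory Submission
  imports Defs
begin

text \<open>Write a, b, c, d for the generators. Higman's group is the amalgam of \<open>A = \<langle>a, b, c\<rangle>\<close> and
  \<open>B = \<langle>c, d, a\<rangle>\<close> over the free group \<open>C = \<langle>a, c\<rangle>\<close>, and A is the amalgam of two Baumslag-Solitar groups over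
  \<open>\<langle>b\<rangle>\<close>. Suppose that an amalgam of A and B over C acts on an ordered set Y so that C acts freely. Then
  skew products over Y, with cocycles that are trivial on C, first make A and B act freely, and
  then twist the two factors independently by order automorphisms of the line attached to C-orbits;
  a suitable twist moves a point under any given alternating word. So the amalgam is separated by
  actions on ordered sets, hence left-orderable, whenever A and B are.

  For A one takes for Y the affine line, on which b is a translation. For Higman's group, b and d act
  on the free product of two copies of the additive group of the reals by left multiplication with its
  canonical generators, while a and c act by rescaling exponents, b and d being slowed down
  by the relations \<open>c\<^sup>t b\<^sup>r = b\<^sup>r c\<^bsup>t / 2^r\<^esup>\<close>. This preserves the left order in which an element is positive
  when most of its syllables are. A second copy of the free product, multiplied by powers with the rescaled
  exponents, makes \<open>\<langle>a, c\<rangle>\<close> act freely.\<close>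

section \<open>Words and their actions\<close>

text \<open>An amalgam of left-orderable groups can fail to be left-orderable, because orders of the
  factors need not match on the common subgroup. The action on Y replaces such a matching, and
  finding it is the real difficulty. The affine line serves for A, where the amalgamated part is
  cyclic; in Higman's group the relations run in a cycle, so every generator rescales its successor
  and is rescaled by its predecessor. Exponents are real because moving a^t past d^r turns t into t
  * 2^(-r), and exponents of b are then multiplied by 2 to that power; the reals are closed under
  all of this. No normal form theorem for amalgams and no embedding of the factors is presupposed:
  groups are words modulo \<open>eqv\<close>, and freeness reads "a word that fixes a point is
  equivalent to \<open>[]\<close>". The amalgam theorem is applied twice: the order that it yields
  on A supplies the regular actions for its application to Higman's group.\<close>

lemma exhaust4: "i = 0 \<or> i = 1 \<or> i = 2 \<or> i = (3::4)"
  using exhaust_4[of i] by auto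

lemma UNIV4: "(UNIV :: 4 set) = {0, 1, 2, 3}"
  using exhaust4 by auto

text \<open>Only the relators vary while the alphabet stays fixed, so the Baumslag-Solitar groups,
  A, Higman's group and the free group (\<open>R = {}\<close>) share all results on words.\<close>

inductive eqv :: "hword set \<Rightarrow> hword \<Rightarrow> hword \<Rightarrow> bool" for R where
  refl: "eqv R w w"
| sym: "eqv R v w \<Longrightarrow> eqv R w v"
| trans: "eqv R u v \<Longrightarrow> eqv R v w \<Longrightarrow> eqv R u w"
| cancel: "eqv R (u @ [x, inv_letter x] @ v) (u @ v)"
| rel: "r \<in> R \<Longrightarrow> eqv R (u @ r @ v) (u @ v)"

lemma higman_eqv_eq: "higman_eqv = eqv (range higman_relator)"
proof (intro ext iffI)
  fix u v
  show "higman_eqv u v \<Longrightarrow> eqv (range higman_relator) u v"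
    by (induction rule: higman_eqv.induct) (blast intro: eqv.intros)+
  show "eqv (range higman_relator) u v \<Longrightarrow> higman_eqv u v"
    by (induction rule: eqv.induct) (blast intro: higman_eqv.intros)+
qed

lemma eqv_app: "eqv R u v \<Longrightarrow> eqv R (x @ u @ y) (x @ v @ y)"
proof (induction rule: eqv.induct)
  case (cancel u l v) then show ?case using eqv.cancel[of R "x @ u" l "v @ y"] by simp
next
  case (rel r u v) then show ?case using eqv.rel[of r R "x @ u" "v @ y"] by simp
qed (auto intro: eqv.intros)

lemma eqv_append: "eqv R u u' \<Longrightarrow> eqv R v v' \<Longrightarrow> eqv R (u @ v) (u' @ v')"
  using eqv_app[of R u u' "[]" v] eqv_app[of R v v' u' "[]"] by (auto intro: eqv.trans)

definition winv :: "hword \<Rightarrow> hword" where "winv w = rev (map inv_letter w)"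

lemma winv_simps [simp]: "winv [] = []" "winv (l # w) = winv w @ [inv_letter l]"
  "winv (u @ v) = winv v @ winv u"
  by (auto simp: winv_def)

lemma inv_letter_invol [simp]: "inv_letter (inv_letter l) = l"
  by (simp add: inv_letter_def)

lemma winv_invol [simp]: "winv (winv w) = w"
  by (induction w) auto

lemma eqv_inv_right: "eqv R (w @ winv w) []"
proof (induction w)
  case (Cons l w)
  show ?case using eqv_app[OF Cons, of "[l]" "[inv_letter l]"] eqv.cancel[of R "[]" l "[]"]
    by (auto intro: eqv.trans)
qed (auto intro: eqv.refl)

lemma eqv_inv_left: "eqv R (winv w @ w) []"
  using eqv_inv_right[of R "winv w"] by simp

lemma eqv_iff: "eqv R u v \<longleftrightarrow> eqv R (winv u @ v) []"
proof
  assume "eqv R u v"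
  then have "eqv R (winv u @ v) (winv u @ u)"
    by (intro eqv_append eqv.refl) (rule eqv.sym)
  then show "eqv R (winv u @ v) []" using eqv_inv_left eqv.trans by blast
next
  assume "eqv R (winv u @ v) []"
  then have "eqv R (u @ winv u @ v) u" using eqv_app[of R _ "[]" u "[]"] by simp
  moreover have "eqv R (u @ winv u @ v) v" using eqv_app[OF eqv_inv_right[of R u], of "[]" v] by simp
  ultimately show "eqv R u v" using eqv.sym eqv.trans by blast
qed

lemma eqv_winv: "eqv R u v \<Longrightarrow> eqv R (winv u) (winv v)"
proof (rule eqv.sym, subst eqv_iff, simp)
  assume a: "eqv R u v"
  show "eqv R (v @ winv u) []"
    using eqv_append[OF eqv.sym[OF a] eqv.refl[of R "winv u"]] eqv_inv_right eqv.trans by blast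
qed

lemma eqv_mono: "eqv R u v \<Longrightarrow> R \<subseteq> R' \<Longrightarrow> eqv R' u v"
  by (induction rule: eqv.induct) (blast intro: eqv.intros)+

definition wd :: "4 set \<Rightarrow> hword set" where "wd J = {w. fst ` set w \<subseteq> J}"

lemma wd_simps [simp]: "[] \<in> wd J" "l # w \<in> wd J \<longleftrightarrow> fst l \<in> J \<and> w \<in> wd J"
  "u @ v \<in> wd J \<longleftrightarrow> u \<in> wd J \<and> v \<in> wd J" "wd UNIV = UNIV"
  by (auto simp: wd_def)

lemma wd_winv [simp]: "winv w \<in> wd J \<longleftrightarrow> w \<in> wd J"
  by (induction w) (auto simp: inv_letter_def)

lemma wd_Int: "w \<in> wd (J \<inter> K) \<longleftrightarrow> w \<in> wd J \<and> w \<in> wd K"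
  by (auto simp: wd_def)

abbreviation finv :: "('x \<Rightarrow> 'y) \<Rightarrow> 'y \<Rightarrow> 'x" where
  "finv f \<equiv> inv_into UNIV f"

definition letter_act :: "(4 \<Rightarrow> 'x \<Rightarrow> 'x) \<Rightarrow> hletter \<Rightarrow> 'x \<Rightarrow> 'x" where
  "letter_act \<rho> l = (if snd l then finv (\<rho> (fst l)) else \<rho> (fst l))"

primrec act :: "(4 \<Rightarrow> 'x \<Rightarrow> 'x) \<Rightarrow> hword \<Rightarrow> 'x \<Rightarrow> 'x" where
  "act \<rho> [] = (\<lambda>x. x)"
| "act \<rho> (l # w) = (\<lambda>x. letter_act \<rho> l (act \<rho> w x))"

lemma act_append [simp]: "act \<rho> (u @ v) x = act \<rho> u (act \<rho> v x)"
  by (induction u) auto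

section \<open>Order automorphisms and actions by them\<close>

definition oaut :: "('x::linorder \<Rightarrow> 'x) \<Rightarrow> bool" where
  "oaut f \<longleftrightarrow> bij f \<and> strict_mono f"

lemma oaut_id [simp]: "oaut id" "oaut (\<lambda>x. x)"
  by (auto simp: oaut_def strict_mono_def bij_def inj_on_def)

lemma oaut_comp: "oaut f \<Longrightarrow> oaut g \<Longrightarrow> oaut (\<lambda>x. f (g x))"
  using bij_comp[of g f] by (auto simp: oaut_def strict_mono_def comp_def)

lemma oaut_less [simp]: "oaut f \<Longrightarrow> f x < f y \<longleftrightarrow> x < y"
  by (auto simp: oaut_def strict_mono_less)

lemma oaut_inv_f [simp]: "oaut f \<Longrightarrow> finv f (f x) = x"
  by (simp add: oaut_def bij_is_inj)

lemma oaut_f_inv [simp]: "oaut f \<Longrightarrow> f (finv f x) = x"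
  by (simp add: oaut_def bij_is_surj surj_f_inv_f)

lemma oaut_eq [simp]: "oaut f \<Longrightarrow> f x = f y \<longleftrightarrow> x = y"
  by (metis oaut_inv_f)

lemma oaut_inv: "oaut f \<Longrightarrow> oaut (finv f)"
  by (metis bij_imp_bij_inv oaut_def oaut_f_inv oaut_less strict_monoI)

lemma oautI: "strict_mono f \<Longrightarrow> (\<And>x. f (g x) = x) \<Longrightarrow> oaut f"
  by (metis bijI oaut_def strict_mono_imp_inj_on surjI)

definition oact :: "hword set \<Rightarrow> (4 \<Rightarrow> 'x::linorder \<Rightarrow> 'x) \<Rightarrow> bool" where
  "oact R \<rho> \<longleftrightarrow> (\<forall>i. oaut (\<rho> i)) \<and> (\<forall>r\<in>R. \<forall>x. act \<rho> r x = x)"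

lemma oactD: "oact R \<rho> \<Longrightarrow> oaut (\<rho> i)"
  by (simp add: oact_def)

lemma oaut_letter_act: "oact R \<rho> \<Longrightarrow> oaut (letter_act \<rho> l)"
  by (simp add: letter_act_def oact_def oaut_inv)

lemma oaut_act: "oact R \<rho> \<Longrightarrow> oaut (act \<rho> w)"
  by (induction w) (auto simp del: split_paired_All intro: oaut_comp oaut_letter_act)

lemma letter_act_inv [simp]:
  "oact R \<rho> \<Longrightarrow> letter_act \<rho> l (letter_act \<rho> (inv_letter l) x) = x"
  "oact R \<rho> \<Longrightarrow> letter_act \<rho> (inv_letter l) (letter_act \<rho> l x) = x"
  by (auto simp: letter_act_def inv_letter_def oact_def)

lemma act_winv [simp]:
  assumes "oact R \<rho>" shows "act \<rho> w (act \<rho> (winv w) x) = x" "act \<rho> (winv w) (act \<rho> w x) = x"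
  using assms by (induction w arbitrary: x) auto

lemma act_eqv: "eqv R u v \<Longrightarrow> oact R \<rho> \<Longrightarrow> act \<rho> u x = act \<rho> v x"
proof (induction arbitrary: x rule: eqv.induct)
  case (cancel u l v) then show ?case by (simp del: split_paired_All)
next
  case (rel r u v) then show ?case by (simp add: oact_def)
qed auto

lemma oact_relatorI:
  assumes "\<And>i. oaut (\<rho> i)" "\<And>x. \<rho> i (\<rho> (i + 1) x) = \<rho> (i + 1) (\<rho> (i + 1) (\<rho> i x))"
  shows "act \<rho> (higman_relator i) x = x"
proof -
  define y where "y = finv (\<rho> i) (finv (\<rho> (i + 1)) (finv (\<rho> (i + 1)) x))"
  have "x = \<rho> (i + 1) (\<rho> (i + 1) (\<rho> i y))" using assms(1) by (simp add: y_def)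
  then show ?thesis using assms by (simp add: higman_relator_def letter_act_def y_def)
qed

section \<open>Lexicographic products, the first coordinate being the base and the second the
  fibre\<close>

datatype ('a, 'b) lex = Lex (lfst: 'a) (lsnd: 'b)

instantiation lex :: (linorder, linorder) linorder
begin
definition less_lex :: "('a, 'b) lex \<Rightarrow> ('a, 'b) lex \<Rightarrow> bool" where
  "less_lex p q \<longleftrightarrow> lfst p < lfst q \<or> lfst p = lfst q \<and> lsnd p < lsnd q"
definition less_eq_lex :: "('a, 'b) lex \<Rightarrow> ('a, 'b) lex \<Rightarrow> bool" where
  "less_eq_lex p q \<longleftrightarrow> p = q \<or> p < q"
instance
proof
  fix p q r :: "('a, 'b) lex"
  show "p < q \<longleftrightarrow> p \<le> q \<and> \<not> q \<le> p" "p \<le> p" "p \<le> q \<Longrightarrow> q \<le> p \<Longrightarrow> p = q"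
    "p \<le> q \<Longrightarrow> q \<le> r \<Longrightarrow> p \<le> r" "p \<le> q \<or> q \<le> p"
    by (cases p; cases q; cases r; auto simp: less_lex_def less_eq_lex_def)+
qed
end

lemma less_Lex [simp]: "Lex a b < Lex c d \<longleftrightarrow> a < c \<or> a = c \<and> b < d"
  by (simp add: less_lex_def)

lemma oaut_lexI:
  assumes "oaut f" "\<And>a. oaut (g a)" "\<And>a b. F (Lex a b) = Lex (f a) (g a b)"
  shows "oaut F"
proof (rule oautI[where g = "\<lambda>p. Lex (finv f (lfst p)) (finv (g (finv f (lfst p))) (lsnd p))"])
  show "strict_mono F"
  proof (rule strict_monoI)
    fix p q :: "('a, 'b) lex" assume "p < q"
    then show "F p < F q" using assms by (cases p; cases q) auto
  qed
qed (use assms in auto)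

section \<open>The free product of two copies of the real line\<close>

type_synonym syl = "bool \<times> real"

primrec red :: "syl list \<Rightarrow> bool" where
  "red [] = True"
| "red (x # s) = (snd x \<noteq> 0 \<and> (s = [] \<or> fst x \<noteq> fst (hd s)) \<and> red s)"

lemma red_append: "red (s @ t) \<longleftrightarrow> red s \<and> red t \<and> (s = [] \<or> t = [] \<or> fst (last s) \<noteq> fst (hd t))"
  by (induction s) (auto simp: hd_append)

definition sh :: "syl \<Rightarrow> syl list \<Rightarrow> syl list" where
  "sh x s = (if snd x = 0 then s else case s of [] \<Rightarrow> [x]
     | y # s' \<Rightarrow> if fst y = fst x
         then if snd x + snd y = 0 then s' else (fst x, snd x + snd y) # s'
         else x # s)"

lemma red_sh: "red s \<Longrightarrow> red (sh x s)"
  by (auto simp: sh_def split: list.split)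

lemma sh_sh: "red s \<Longrightarrow> sh (k, a) (sh (k, b) s) = sh (k, a + b) s"
  by (cases s) (auto simp: sh_def split: list.split)

lemma sh_Cons: "red (x # s) \<Longrightarrow> sh x s = x # s"
  by (auto simp: sh_def split: list.split)

definition mul :: "syl list \<Rightarrow> syl list \<Rightarrow> syl list" where "mul s t = foldr sh s t"

lemma mul_simps [simp]: "mul [] t = t" "mul (x # s) t = sh x (mul s t)"
  "mul (r @ s) t = mul r (mul s t)"
  by (auto simp: mul_def)

lemma red_mul: "red t \<Longrightarrow> red (mul s t)"
  by (induction s) (auto intro: red_sh)

text \<open>Van der Waerden's trick: the product lets syllables act one at a time, so associativity
  rests on this one-syllable case. It comes from \<open>sh_sh\<close>: syllables of one type act as
  the additive group of the reals.\<close>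

lemma mul_sh:
  assumes "red t" shows "mul (sh x s) t = sh x (mul s t)"
proof (cases s)
  case (Cons y u)
  have "sh (k, a) (sh (k, b) (mul u t)) = sh (k, a + b) (mul u t)" for k a b
    using assms by (intro sh_sh red_mul)
  note * = this[of "fst x" "snd x" "snd y"]
  have z: "sh (k, 0) v = v" for k v by (simp add: sh_def)
  show ?thesis
  proof (cases "fst y = fst x \<and> snd x \<noteq> 0")
    case True
    then have "sh x s = (if snd x + snd y = 0 then u else (fst x, snd x + snd y) # u)"
      by (simp add: sh_def Cons)
    then show ?thesis using * True z by (cases x; cases y) (auto simp: Cons)
  next
    case False
    then consider "snd x = 0" | "sh x s = x # s" unfolding sh_def Cons by (cases "snd x = 0") auto
    then show ?thesis by cases (auto simp: sh_def)
  qed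
qed (simp add: sh_def)

lemma mul_assoc: "red u \<Longrightarrow> mul (mul s t) u = mul s (mul t u)"
  by (induction s) (auto simp: mul_sh)

lemma mul_append: "red (s @ t) \<Longrightarrow> mul s t = s @ t"
  by (induction s) (auto simp: sh_Cons hd_append split: if_splits)

lemma mul_Nil: "red s \<Longrightarrow> mul s [] = s"
  using mul_append[of s "[]"] by simp

definition ninv :: "syl list \<Rightarrow> syl list" where
  "ninv s = rev (map (\<lambda>x. (fst x, - snd x)) s)"

lemma red_ninv: "red s \<Longrightarrow> red (ninv s)"
  by (induction s) (auto simp: ninv_def red_append last_rev hd_map)

lemma mul_ninv: "red s \<Longrightarrow> mul (ninv s) s = []"
proof (induction s)
  case (Cons x s)
  have "mul (ninv (x # s)) (x # s) = mul (ninv s) (sh (fst x, - snd x) (x # s))"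
    by (simp add: ninv_def)
  also have "sh (fst x, - snd x) (x # s) = s" using Cons(2) by (simp add: sh_def)
  finally show ?case using Cons by simp
qed (simp add: ninv_def)

section \<open>Sign sums and the positive cone\<close>

definition sg :: "syl list \<Rightarrow> real" where "sg s = (\<Sum>x\<leftarrow>s. sgn (snd x))"

lemma sg_simps [simp]: "sg [] = 0" "sg (x # s) = sgn (snd x) + sg s" "sg (s @ t) = sg s + sg t"
  by (auto simp: sg_def)

lemma sg_ninv: "sg (ninv s) = - sg s"
  by (induction s) (auto simp: ninv_def sgn_minus)

text \<open>Types alternate in a reduced word, so its end types agree exactly when the number of
  syllables is odd, and a sum of signs has the parity of their number.\<close>

lemma sg_parity:
  "red s \<Longrightarrow> s \<noteq> [] \<Longrightarrow> \<exists>n::int. sg s = 2 * real_of_int n + (if fst (hd s) = fst (last s) then 1 else 0)"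
proof (induction s)
  case (Cons x s)
  have x: "sgn (snd x) = 1 \<or> sgn (snd x) = -1" using Cons by (auto simp: sgn_if)
  show ?case
  proof (cases "s = []")
    case True
    then show ?thesis using x by (auto intro: exI[of _ 0] exI[of _ "-1"])
  next
    case False
    then obtain n :: int where n: "sg s = 2 * real_of_int n + (if fst (hd s) = fst (last s) then 1 else 0)"
      using Cons by auto
    have h: "fst x \<noteq> fst (hd s)" using Cons False by auto
    consider "sgn (snd x) = 1" | "sgn (snd x) = -1" using x by auto
    then show ?thesis
    proof cases
      case 1
      then show ?thesis using n h False
        by (intro exI[of _ "if fst (hd s) = fst (last s) then n + 1 else n"]) auto
    next
      case 2
      then show ?thesis using n h False
        by (intro exI[of _ "if fst (hd s) = fst (last s) then n else n - 1"]) auto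
    qed
  qed
qed auto

lemma sg_integer: "red s \<Longrightarrow> \<exists>n::int. sg s = n"
proof (cases "s = []")
  case False
  assume "red s"
  then obtain n :: int where "sg s = 2 * real_of_int n + (if fst (hd s) = fst (last s) then 1 else 0)"
    using sg_parity False by blast
  then show ?thesis by (intro exI[of _ "2 * n + (if fst (hd s) = fst (last s) then 1 else 0)"]) auto
qed (auto intro: exI[of _ 0])

lemma sg_zero: "red s \<Longrightarrow> s \<noteq> [] \<Longrightarrow> sg s = 0 \<Longrightarrow> fst (hd s) \<noteq> fst (last s)"
proof
  assume "red s" "s \<noteq> []" "sg s = 0" "fst (hd s) = fst (last s)"
  then obtain n :: int where "0 = 2 * real_of_int n + 1" using sg_parity[of s] by auto
  then have "0 = 2 * n + 1" by linarith
  then show False by presburger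
qed

text \<open>The first syllable breaks the tie at sum 0. A nonempty reduced word of sum 0 has
  different end types by \<open>sg_zero\<close>, so inversion reverses the verdict.\<close>

definition pos :: "syl list \<Rightarrow> bool" where
  "pos s \<longleftrightarrow> sg s > 0 \<or> sg s = 0 \<and> s \<noteq> [] \<and> fst (hd s)"

lemma pos_ninv: "red s \<Longrightarrow> s \<noteq> [] \<Longrightarrow> pos (ninv s) \<longleftrightarrow> \<not> pos s"
  using sg_zero[of s] by (auto simp: pos_def sg_ninv) (auto simp: ninv_def hd_rev last_map)

text \<open>When the last syllable of s and the first of t have the same type, the product either
  cancels completely or merges one pair of syllables, and merging changes the sum of signs by one.\<close>
lemma sg_mul:
  assumes "red s" "red t" "s \<noteq> []" "t \<noteq> []" "fst (last s) = fst (hd t)"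
  shows "sg (mul s t) = sg s + sg t \<or>
    (sg (mul s t) \<ge> sg s + sg t - 1 \<and> mul s t \<noteq> [] \<and>
     fst (hd (mul s t)) = fst (hd s) \<and> fst (last (mul s t)) = fst (last t))"
  using assms
proof (induction s arbitrary: t rule: rev_induct)
  case (snoc x s)
  obtain y u where t: "t = y # u" using snoc by (cases t) auto
  have xy: "fst x = fst y" using snoc t by auto
  have nz: "snd x \<noteq> 0" "snd y \<noteq> 0" and rs: "red s" "red u" using snoc t by (auto simp: red_append)
  show ?case
  proof (cases "snd x + snd y = 0")
    case True
    then have m: "mul (s @ [x]) t = mul s u" using nz xy by (simp add: t sh_def)
    have sg: "sg (s @ [x]) + sg t = sg s + sg u"
      using True by (simp add: t add_eq_0_iff2 sgn_minus)
    show ?thesis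
    proof (cases "s = [] \<or> u = []")
      case True then show ?thesis using m sg mul_Nil[OF rs(1)] by auto
    next
      case False
      then have "fst (last s) = fst (hd u)" using snoc t xy by (auto simp: red_append)
      from snoc.IH[OF rs _ _ this] False show ?thesis unfolding m sg by (auto simp: t)
    qed
  next
    case False
    let ?z = "(fst x, snd x + snd y)"
    have r: "red (s @ ?z # u)" using snoc t xy False by (auto simp: red_append)
    have m: "mul (s @ [x]) t = s @ ?z # u" using nz xy False mul_append[OF r] by (simp add: t sh_def)
    have "sgn (snd x + snd y) \<ge> sgn (snd x) + sgn (snd y) - 1"
      using nz by (auto simp: sgn_if)
    then show ?thesis unfolding m using xy by (auto simp: t hd_append)
  qed
qed auto

text \<open>Only a merge can lower the sign sum, by one, and it requires equal types where the
  factors meet. Two positive words of sum 0 never meet so, as each starts with type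
  \<open>True\<close> and ends with \<open>False\<close>; integrality then keeps the sum of the
  product nonnegative.\<close>

lemma pos_mul:
  assumes r: "red s" "red t" and p: "pos s" "pos t" shows "pos (mul s t)"
proof -
  have nn: "s \<noteq> []" "t \<noteq> []" using p by (auto simp: pos_def)
  have ge1: "red u \<Longrightarrow> sg u > 0 \<Longrightarrow> sg u \<ge> 1" for u using sg_integer[of u] by auto
  show ?thesis
  proof (cases "fst (last s) = fst (hd t)")
    case False
    then have m: "mul s t = s @ t" using r nn by (simp add: mul_append red_append)
    show ?thesis unfolding m using p nn by (auto simp: pos_def hd_append)
  next
    case True
    have rm: "red (mul s t)" using r by (simp add: red_mul)
    have z: "sg s \<noteq> 0 \<or> sg t \<noteq> 0" using p True sg_zero[OF r(1) nn(1)] by (auto simp: pos_def)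
    from sg_mul[OF r nn True] show ?thesis
    proof
      assume "sg (mul s t) = sg s + sg t"
      then show ?thesis using p z by (auto simp: pos_def)
    next
      assume a: "sg (mul s t) \<ge> sg s + sg t - 1 \<and> mul s t \<noteq> [] \<and>
        fst (hd (mul s t)) = fst (hd s) \<and> fst (last (mul s t)) = fst (last t)"
      have "sg (mul s t) \<ge> 0" using a p z ge1[OF r(1)] ge1[OF r(2)] by (auto simp: pos_def)
      moreover have "fst (hd (mul s t))" if "sg (mul s t) = 0"
      proof (cases "sg s = 0")
        case True then show ?thesis using a p by (auto simp: pos_def)
      next
        case False
        \<comment> \<open>Here \<open>s\<close> has sum 1 and \<open>t\<close> has sum 0, so
          \<open>t\<close>, and with it the product, ends with type \<open>False\<close>; sum 0
          forces the other type at the front of the product.\<close>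
        then have "sg t = 0" using a p ge1[OF r(1)] ge1[OF r(2)] that by (auto simp: pos_def)
        then show ?thesis using a p sg_zero[OF r(2) nn(2)] sg_zero[OF rm _ that] by (auto simp: pos_def)
      qed
      ultimately show ?thesis using a by (auto simp: pos_def)
    qed
  qed
qed

text \<open>For \<open>k = True\<close> this pushes a^t rightwards through a word in b (type
  \<open>True\<close>) and d (type \<open>False\<close>), by a^t b^r = b^(2^t r) a^t and a^t d^r =
  d^r a^(t 2^(-r)). For \<open>k = False\<close> it pushes c^t, which rescales d and is slowed down
  by b.\<close>

primrec scl :: "bool \<Rightarrow> real \<Rightarrow> syl list \<Rightarrow> syl list" where
  "scl k t [] = []"
| "scl k t (x # s) = (if fst x = k then (k, 2 powr t * snd x) # scl k t s
                      else x # scl k (t * 2 powr (- snd x)) s)"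

text \<open>The factor by which the pushed exponent has changed when it leaves the word on the
  right.\<close>

primrec ex :: "bool \<Rightarrow> syl list \<Rightarrow> real" where
  "ex k [] = 1"
| "ex k (x # s) = (if fst x = k then 1 else 2 powr (- snd x)) * ex k s"

text \<open>Merging is respected: adjacent syllables of type \<open>k\<close> meet the same factor
  2^t, and for the other type 2^(-a) and 2^(-b) combine to 2^(-(a + b)).\<close>

lemma scl_sh: "scl k t (sh x s) =
    sh (if fst x = k then (k, 2 powr t * snd x) else x)
      (scl k (if fst x = k then t else t * 2 powr (- snd x)) s)"
proof -
  have e: "2 powr t * a + 2 powr t * b = 2 powr t * (a + b)" for a b :: real
    by (simp add: distrib_left)
  have p: "2 powr (- a) * 2 powr (- b) = 2 powr (- (a + b) :: real)" for a b
    by (simp add: powr_add[symmetric])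
  obtain j a where x: "x = (j, a)" by (cases x)
  show ?thesis
  proof (cases s)
    case (Cons y u)
    obtain i b where y: "y = (i, b)" by (cases y)
    show ?thesis
      by (cases "j = k"; cases "i = j"; cases "a = 0"; cases "a + b = 0")
        (simp_all add: sh_def Cons x y e p mult.assoc del: minus_add_distrib)
  qed (simp add: sh_def x)
qed

lemma scl_mul: "scl k t (mul s u) = mul (scl k t s) (scl k (t * ex k s) u)"
  by (induction s arbitrary: t) (auto simp: scl_sh mult.assoc)

lemma ex_sh: "ex k (sh x s) = (if fst x = k then 1 else 2 powr (- snd x)) * ex k s"
proof -
  have p: "2 powr (- a) * (2 powr (- b) * c) = 2 powr (- (a + b)) * c" for a b c :: real
    by (simp add: powr_add[symmetric] flip: mult.assoc)
  obtain j a where x: "x = (j, a)" by (cases x)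
  show ?thesis
  proof (cases s)
    case (Cons y u)
    obtain i b where y: "y = (i, b)" by (cases y)
    show ?thesis
      by (cases "j = k"; cases "i = j"; cases "a = 0"; cases "a + b = 0")
        (simp_all add: sh_def Cons x y p del: minus_add_distrib)
  qed (simp add: sh_def x)
qed

lemma ex_pos: "ex k s > 0"
  by (induction s) auto

lemma ex_scl: "ex k (scl k t s) = ex k s"
  by (induction s arbitrary: t) auto

lemma scl_scl: "scl k a (scl k b s) = scl k (a + b) s"
  by (induction s arbitrary: a b) (auto simp: powr_add distrib_right)

lemma scl_0: "scl k 0 s = s"
  by (induction s) (auto simp: prod_eq_iff)

lemma scl_eq_Nil [simp]: "scl k t s = [] \<longleftrightarrow> s = []"
  by (cases s) auto

lemma fst_hd_scl: "fst (hd (scl k t s)) = fst (hd s)" if "s \<noteq> []"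
  using that by (cases s) auto

lemma red_scl: "red s \<Longrightarrow> red (scl k t s)"
  by (induction s arbitrary: t) (auto simp: fst_hd_scl)

lemma sg_scl: "sg (scl k t s) = sg s"
  by (induction s arbitrary: t) (auto simp: sgn_mult)

lemma pos_scl: "pos (scl k t s) = pos s"
  by (auto simp: pos_def sg_scl fst_hd_scl)

section \<open>The free product as an ordered group, noncommutative but written additively\<close>

typedef fw = "{s. red s}" by (auto intro: exI[of _ "[]"])

setup_lifting type_definition_fw

instantiation fw :: group_add
begin
lift_definition zero_fw :: fw is "[]" by simp
lift_definition plus_fw :: "fw \<Rightarrow> fw \<Rightarrow> fw" is mul by (rule red_mul)
lift_definition uminus_fw :: "fw \<Rightarrow> fw" is ninv by (rule red_ninv)
definition minus_fw :: "fw \<Rightarrow> fw \<Rightarrow> fw" where "minus_fw a b = a + - b"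
instance
  by standard (transfer, simp add: mul_assoc mul_Nil mul_ninv minus_fw_def | simp add: minus_fw_def)+
end

instantiation fw :: linorder
begin
lift_definition less_fw :: "fw \<Rightarrow> fw \<Rightarrow> bool" is "\<lambda>s t. pos (mul (ninv s) t)" .
definition less_eq_fw :: "fw \<Rightarrow> fw \<Rightarrow> bool" where "less_eq_fw a b \<longleftrightarrow> a = b \<or> a < b"
instance
proof -
  have less: "a < b \<longleftrightarrow> pos (Rep_fw (- a + b))" for a b :: fw by transfer simp
  have add: "pos (Rep_fw a) \<Longrightarrow> pos (Rep_fw b) \<Longrightarrow> pos (Rep_fw (a + b))" for a b :: fw
    by transfer (rule pos_mul)
  have neg: "a \<noteq> 0 \<Longrightarrow> pos (Rep_fw (- a)) \<longleftrightarrow> \<not> pos (Rep_fw a)" for a :: fw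
    by transfer (rule pos_ninv)
  have irrefl: "\<not> a < a" for a :: fw unfolding less by simp (transfer, simp add: pos_def)
  have trans: "a < b \<Longrightarrow> b < c \<Longrightarrow> a < c" for a b c :: fw
    using add[of "- a + b" "- b + c"] unfolding less by (simp add: add.assoc)
  have total: "a < b \<or> b < a" if "a \<noteq> b" for a b :: fw
  proof -
    have "- a + b \<noteq> 0" using that by (metis add.right_neutral add_minus_cancel)
    from neg[OF this] show ?thesis unfolding less by (auto simp: minus_add)
  qed
  show "OFCLASS(fw, linorder_class)"
    by standard (auto simp: less_eq_fw_def irrefl dest: trans total)
qed
end

lemma fw_less: "a < b \<longleftrightarrow> pos (Rep_fw (- a + b))" for a b :: fw
  by transfer simp

lift_definition gen :: "bool \<Rightarrow> real \<Rightarrow> fw" is "\<lambda>k t. if t = 0 then [] else [(k, t)]"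
  by simp

lift_definition scale :: "bool \<Rightarrow> real \<Rightarrow> fw \<Rightarrow> fw" is scl by (rule red_scl)

lift_definition wt :: "bool \<Rightarrow> fw \<Rightarrow> real" is ex .

lemma gen_add: "gen k a + gen k b = gen k (a + b)"
  by transfer (auto simp: sh_def)

lemma gen_0: "gen k 0 = 0"
  by transfer simp

lemma scale_add: "scale k t (a + b) = scale k t a + scale k (t * wt k a) b"
  by transfer (rule scl_mul)

lemma scale_gen: "scale k t (gen k r) = gen k (2 powr t * r)" "scale k t (gen (\<not> k) r) = gen (\<not> k) r"
  by (transfer, simp)+

lemma scale_scale: "scale k a (scale k b s) = scale k (a + b) s"
  by (simp add: scale.rep_eq scl_scl flip: Rep_fw_inject)

lemma scale_0: "scale k 0 s = s"
  by transfer (rule scl_0)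

lemma wt_gen: "wt k (gen k r + s) = wt k s" "wt k (gen (\<not> k) r + s) = 2 powr (- r) * wt k s"
  by (transfer, simp add: ex_sh)+

lemma wt_gen1: "wt k (gen k r) = 1" "wt k (gen (\<not> k) r) = 2 powr (- r)"
  by (transfer, simp)+

lemma wt_scale: "wt k (scale k t s) = wt k s"
  by transfer (rule ex_scl)

lemma wt_pos: "wt k s > 0"
  by transfer (rule ex_pos)

lemma oaut_add: "oaut (\<lambda>x. a + x)" for a :: fw
  by (rule oautI[where g = "\<lambda>x. - a + x"])
    (auto intro!: strict_monoI simp: fw_less minus_add add.assoc diff_conv_add_uminus
      simp del: add_uminus_conv_diff)

text \<open>\<open>scale\<close> is only a crossed homomorphism, but it turns the difference
  \<open>- a + b\<close> into a rescaling of that difference by another parameter. Rescaling keeps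
  the types and signs of all syllables, hence positivity.\<close>

lemma oaut_scale: "oaut (scale k t)"
proof (rule oautI[where g = "scale k (- t)"])
  show "strict_mono (scale k t)"
  proof (rule strict_monoI)
    fix a b :: fw assume l: "a < b"
    define d where "d = - a + b"
    have b: "b = a + d" by (simp add: d_def flip: add.assoc)
    have "- scale k t a + scale k t b = scale k (t * wt k a) d"
      unfolding b by (simp add: scale_add flip: add.assoc)
    moreover have "pos (Rep_fw (scale k u d)) = pos (Rep_fw d)" for u
      by transfer (rule pos_scl)
    ultimately show "scale k t a < scale k t b" using l unfolding fw_less d_def by simp
  qed
qed (simp add: scale_scale scale_0)

lemma finv_eqI: "oaut f \<Longrightarrow> f q = p \<Longrightarrow> finv f p = q"
  by (metis oaut_inv_f)

section \<open>Extending finite partial order isomorphisms of the line\<close>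

lemma oaut_bend:
  fixes b l :: real assumes "l > 0"
  shows "oaut (\<lambda>y. if y \<le> b then y else b + (y - b) * l)"
proof (rule oautI[where g = "\<lambda>y. if y \<le> b then y else b + (y - b) / l"])
  show "strict_mono (\<lambda>y. if y \<le> b then y else b + (y - b) * l)"
  proof (rule strict_monoI)
    fix x y :: real assume "x < y"
    then show "(if x \<le> b then x else b + (x - b) * l) < (if y \<le> b then y else b + (y - b) * l)"
      using assms mult_pos_pos[of "y - b" l] by (auto simp: not_le intro: le_less_trans)
  qed
  fix x :: real
  have "x > b \<Longrightarrow> (x - b) / l > 0" using assms by simp
  then show "(if (if x \<le> b then x else b + (x - b) / l) \<le> b then if x \<le> b then x else b + (x - b) / l
    else b + ((if x \<le> b then x else b + (x - b) / l) - b) * l) = x"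
    using assms by (auto simp: divide_le_0_iff)
qed

lemma oaut_translation: "oaut (\<lambda>x. x + c)" for c :: real
  by (rule oautI[where g = "\<lambda>x. x - c"]) (auto intro: strict_monoI)

text \<open>Induction removes the largest argument a. An extension g for the remaining points is
  corrected by bending the line above their largest value b0, which leaves the values already
  prescribed in place.\<close>

lemma partial_iso_extends:
  fixes Q :: "(real \<times> real) set"
  assumes "finite Q" "\<And>x y x' y'. (x, y) \<in> Q \<Longrightarrow> (x', y') \<in> Q \<Longrightarrow> x < x' \<longleftrightarrow> y < y'"
  shows "\<exists>f. oaut f \<and> (\<forall>(x, y)\<in>Q. f x = y)"
  using assms
proof (induction "card Q" arbitrary: Q)
  case 0 then show ?case by (auto intro: exI[of _ id])
next
  case (Suc n)
  have "Q \<noteq> {}" using Suc.hyps by auto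
  then have "Max (fst ` Q) \<in> fst ` Q" using Suc.prems by (intro Max_in) auto
  then obtain a b where ab: "(a, b) \<in> Q" "a = Max (fst ` Q)" by auto
  have amax: "x \<le> a" if "(x, y) \<in> Q" for x y
    unfolding ab(2) using that Suc.prems by (intro Max_ge) (auto simp: image_iff intro: bexI[of _ "(x, y)"])
  define Q' where "Q' = Q - {(a, b)}"
  have Q: "Q = insert (a, b) Q'" using ab by (auto simp: Q'_def)
  have "n = card Q'" using Suc.hyps(2) ab Suc.prems by (simp add: Q'_def)
  from Suc.hyps(1)[OF this] Suc.prems obtain g where g: "oaut g" "\<And>x y. (x, y) \<in> Q' \<Longrightarrow> g x = y"
    unfolding Q'_def by (smt (verit) DiffD1 case_prodD finite_Diff)
  show ?case
  proof (cases "Q' = {}")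
    case True then show ?thesis unfolding Q using oaut_translation[of "b - a"] by (intro exI) auto
  next
    case False
    then have "Max (fst ` Q') \<in> fst ` Q'" using Suc.prems Q by (intro Max_in) auto
    then obtain a0 b0 where ab0: "(a0, b0) \<in> Q'" "a0 = Max (fst ` Q')" by auto
    have max0: "x \<le> a0" if "(x, y) \<in> Q'" for x y
      unfolding ab0(2) using that Suc.prems Q by (intro Max_ge) (auto simp: image_iff intro: bexI[of _ "(x, y)"])
    have in0: "(a0, b0) \<in> Q" using ab0 Q by auto
    have "a0 \<noteq> a" using Suc.prems(2)[OF in0 ab(1)] Suc.prems(2)[OF ab(1) in0] ab0 by (auto simp: Q'_def)
    then have lt: "a0 < a" "b0 < b" using amax[OF in0] Suc.prems(2)[OF in0 ab(1)] by auto
    have ga: "b0 < g a" using g(2)[OF ab0(1)] oaut_less[OF g(1), of a0 a] lt by auto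
    \<comment> \<open>The slope that makes the bend send \<open>g a\<close> to
      \<open>b\<close>.\<close>
    define l where "l = (b - b0) / (g a - b0)"
    define h where "h = (\<lambda>y. if y \<le> b0 then y else b0 + (y - b0) * l)"
    have "l > 0" using lt ga by (simp add: l_def)
    then have h: "oaut h" unfolding h_def by (rule oaut_bend)
    have "h (g a) = b" using ga by (simp add: h_def l_def)
    moreover have "h (g x) = y" if xy: "(x, y) \<in> Q'" for x y
    proof -
      have "\<not> b0 < y" using max0[OF xy] Suc.prems(2)[OF in0, of x y] xy Q by auto
      then show ?thesis using g(2)[OF xy] by (simp add: h_def)
    qed
    ultimately show ?thesis unfolding Q
      by (intro exI[of _ "\<lambda>x. h (g x)"]) (auto intro: oaut_comp h g)
  qed
qed

text \<open>A word in which consecutive letters have different keys can be made to push 0 upwards by one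
  at each letter: letters with equal keys then impose constraints on disjoint pairs of integers,
  and these are order preserving.\<close>
lemma upward_path:
  fixes ls :: "('k \<times> bool) list"
  assumes "\<And>i. Suc i < length ls \<Longrightarrow> fst (ls ! i) \<noteq> fst (ls ! Suc i)"
  shows "\<exists>M :: 'k \<Rightarrow> real \<Rightarrow> real. (\<forall>k. oaut (M k)) \<and>
    (\<forall>i<length ls. (if snd (ls ! i) then finv (M (fst (ls ! i))) else M (fst (ls ! i))) (real i) = real (Suc i))"
proof -
  \<comment> \<open>Constraints are always stored for \<open>M\<close> itself, so an inverse letter
    contributes the reversed pair.\<close>
  define pr where "pr i = (if snd (ls ! i) then (real (Suc i), real i) else (real i, real (Suc i)))" for i
  define Q where "Q k = pr ` {i. i < length ls \<and> fst (ls ! i) = k}" for k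
  have "\<exists>f. oaut f \<and> (\<forall>(x, y)\<in>Q k. f x = y)" for k
  proof (rule partial_iso_extends)
    fix x y x' y' assume "(x, y) \<in> Q k" "(x', y') \<in> Q k"
    then obtain i j where ij: "(x, y) = pr i" "(x', y') = pr j" "i < length ls" "j < length ls"
      "fst (ls ! i) = k" "fst (ls ! j) = k" by (auto simp: Q_def)
    have "j \<noteq> Suc i" "i \<noteq> Suc j" using assms[of i] assms[of j] ij by auto
    then consider "i = j" | "Suc i < j" | "Suc j < i" by linarith
    then show "x < x' \<longleftrightarrow> y < y'" using ij(1,2) by cases (auto simp: pr_def split: if_splits)
  qed (simp add: Q_def)
  then have "\<forall>k. \<exists>f. oaut f \<and> (\<forall>(x, y)\<in>Q k. f x = y)" by blast
  then obtain M where "\<forall>k. oaut (M k) \<and> (\<forall>(x, y)\<in>Q k. M k x = y)" by (rule choice[THEN exE])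
  then have M: "\<And>k. oaut (M k)" "\<And>k x y. (x, y) \<in> Q k \<Longrightarrow> M k x = y" by auto
  have "(if snd (ls ! i) then finv (M (fst (ls ! i))) else M (fst (ls ! i))) (real i) = real (Suc i)"
    if "i < length ls" for i
  proof -
    have "pr i \<in> Q (fst (ls ! i))" using that by (auto simp: Q_def)
    then have "M (fst (ls ! i)) (fst (pr i)) = snd (pr i)" using M(2) by (cases "pr i") auto
    then show ?thesis by (cases "snd (ls ! i)") (auto simp: pr_def intro: finv_eqI[OF M(1)])
  qed
  then show ?thesis using M(1) by blast
qed

section \<open>Skew products\<close>

lemma act_trivial [simp]: "act (\<lambda>_ x. x) w x = x"
  by (induction w) (auto simp: letter_act_def inv_f_eq)

text \<open>The fibre cocycle u(w y) \<theta>(w) u(y)^(-1) telescopes along words within one factor,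
  and every relator lies in one factor, so relators hold automatically. What must be demanded is
  that both formulas agree on the shared generators.\<close>

lemma skew_product:
  fixes \<rho> :: "4 \<Rightarrow> 'y::linorder \<Rightarrow> 'y" and \<theta>A \<theta>B :: "4 \<Rightarrow> 'e::linorder \<Rightarrow> 'e" and uA uB :: "'y \<Rightarrow> 'e \<Rightarrow> 'e"
  assumes J: "JA \<union> JB = UNIV" and R: "RA \<subseteq> wd JA" "RB \<subseteq> wd JB"
    and \<rho>: "oact (RA \<union> RB) \<rho>" and \<theta>: "oact RA \<theta>A" "oact RB \<theta>B"
    and u: "\<And>y. oaut (uA y)" "\<And>y. oaut (uB y)"
    and compat: "\<And>i y e. i \<in> JA \<inter> JB \<Longrightarrow>
      uA (\<rho> i y) (\<theta>A i (finv (uA y) e)) = uB (\<rho> i y) (\<theta>B i (finv (uB y) e))"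
  obtains \<rho>' :: "4 \<Rightarrow> ('y, 'e) lex \<Rightarrow> ('y, 'e) lex" where "oact (RA \<union> RB) \<rho>'"
    "\<And>w p. lfst (act \<rho>' w p) = act \<rho> w (lfst p)"
    "\<And>w y e. w \<in> wd JA \<Longrightarrow>
       act \<rho>' w (Lex y e) = Lex (act \<rho> w y) (uA (act \<rho> w y) (act \<theta>A w (finv (uA y) e)))"
    "\<And>w y e. w \<in> wd JB \<Longrightarrow>
       act \<rho>' w (Lex y e) = Lex (act \<rho> w y) (uB (act \<rho> w y) (act \<theta>B w (finv (uB y) e)))"
proof -
  define \<rho>' where "\<rho>' i p = (let y = lfst p; e = lsnd p in Lex (\<rho> i y)
     (if i \<in> JA then uA (\<rho> i y) (\<theta>A i (finv (uA y) e)) else uB (\<rho> i y) (\<theta>B i (finv (uB y) e))))" for i p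
  have A: "\<rho>' i (Lex y e) = Lex (\<rho> i y) (uA (\<rho> i y) (\<theta>A i (finv (uA y) e)))" if "i \<in> JA" for i y e
    using that by (simp add: \<rho>'_def)
  have B: "\<rho>' i (Lex y e) = Lex (\<rho> i y) (uB (\<rho> i y) (\<theta>B i (finv (uB y) e)))" if "i \<in> JB" for i y e
    using that compat[of i] by (simp add: \<rho>'_def)
  have o: "oaut (\<rho>' i)" for i
  proof (rule oaut_lexI[where f = "\<rho> i"])
    show "oaut (\<rho> i)" using \<rho> by (rule oactD)
    let ?g = "\<lambda>y. if i \<in> JA then (\<lambda>e. uA (\<rho> i y) (\<theta>A i (finv (uA y) e)))
       else (\<lambda>e. uB (\<rho> i y) (\<theta>B i (finv (uB y) e)))"
    show "\<rho>' i (Lex y e) = Lex (\<rho> i y) (?g y e)" for y e by (simp add: \<rho>'_def)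
    show "oaut (?g y)" for y
      using oaut_comp[OF u(1) oaut_comp[OF oactD[OF \<theta>(1)] oaut_inv[OF u(1)]]]
        oaut_comp[OF u(2) oaut_comp[OF oactD[OF \<theta>(2)] oaut_inv[OF u(2)]]] by simp
  qed
  have word: "act \<rho>' w (Lex y e) = Lex (act \<rho> w y) (v (act \<rho> w y) (act \<theta> w (finv (v y) e)))"
    if g: "\<And>i y e. i \<in> J \<Longrightarrow> \<rho>' i (Lex y e) = Lex (\<rho> i y) (v (\<rho> i y) (\<theta> i (finv (v y) e)))"
      and v: "\<And>y. oaut (v y)" and t: "oact S \<theta>" and w: "w \<in> wd J" for J v \<theta> S w y e
    using w
  proof (induction w)
    case Nil show ?case using v by simp
  next
    case (Cons l w)
    have "letter_act \<rho>' l (Lex z d) = Lex (letter_act \<rho> l z) (v (letter_act \<rho> l z) (letter_act \<theta> l (finv (v z) d)))"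
      for z d
    proof (cases "snd l")
      case True
      have "\<rho>' (fst l) (Lex (finv (\<rho> (fst l)) z) (v (finv (\<rho> (fst l)) z) (finv (\<theta> (fst l)) (finv (v z) d)))) = Lex z d"
        using g[of "fst l"] Cons(2) v oactD[OF \<rho>] oactD[OF t] by simp
      from finv_eqI[OF o this] show ?thesis using True by (simp add: letter_act_def)
    qed (use g Cons in \<open>simp add: letter_act_def\<close>)
    then show ?case using Cons v by simp
  qed
  have wA: "act \<rho>' w (Lex y e) = Lex (act \<rho> w y) (uA (act \<rho> w y) (act \<theta>A w (finv (uA y) e)))"
    if "w \<in> wd JA" for w y e using word[OF A u(1) \<theta>(1) that] .
  have wB: "act \<rho>' w (Lex y e) = Lex (act \<rho> w y) (uB (act \<rho> w y) (act \<theta>B w (finv (uB y) e)))"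
    if "w \<in> wd JB" for w y e using word[OF B u(2) \<theta>(2) that] .
  have rel: "act \<rho>' r p = p" if "r \<in> RA \<union> RB" for r p
    using that R \<rho> \<theta> u wA[of r "lfst p" "lsnd p"] wB[of r "lfst p" "lsnd p"]
    by (cases p) (auto simp: oact_def subset_iff)
  have lf: "lfst (letter_act \<rho>' l p) = letter_act \<rho> l (lfst p)" for l p
  proof -
    have "[l] \<in> wd JA \<or> [l] \<in> wd JB" using J by auto
    then show ?thesis using wA[of "[l]" "lfst p" "lsnd p"] wB[of "[l]" "lfst p" "lsnd p"] by (cases p) auto
  qed
  show ?thesis
  proof (rule that)
    show "oact (RA \<union> RB) \<rho>'" using o rel by (simp add: oact_def)
    show "lfst (act \<rho>' w p) = act \<rho> w (lfst p)" for w p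
      by (induction w) (auto simp: lf simp del: split_paired_All)
  qed (use wA wB in auto)
qed

section \<open>Orbits of the amalgamated part, and making one factor act freely\<close>

definition orb :: "4 set \<Rightarrow> (4 \<Rightarrow> 'y \<Rightarrow> 'y) \<Rightarrow> 'y \<Rightarrow> 'y set" where
  "orb J \<rho> y = {act \<rho> c y | c. c \<in> wd J}"

lemma orb_self: "y \<in> orb J \<rho> y"
  unfolding orb_def by (auto intro: exI[of _ "[]"])

lemma orb_act:
  assumes \<rho>: "oact R \<rho>" and c: "c \<in> wd J" shows "orb J \<rho> (act \<rho> c y) = orb J \<rho> y"
proof -
  have sub: "orb J \<rho> (act \<rho> d z) \<subseteq> orb J \<rho> z" if d: "d \<in> wd J" for d z
  proof
    fix x assume "x \<in> orb J \<rho> (act \<rho> d z)"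
    then obtain b where "b \<in> wd J" "x = act \<rho> (b @ d) z" by (auto simp: orb_def)
    then show "x \<in> orb J \<rho> z" using d unfolding orb_def by (intro CollectI exI[of _ "b @ d"]) simp
  qed
  show ?thesis using sub[OF c, of y] sub[of "winv c" "act \<rho> c y"] c \<rho> by auto
qed

text \<open>The cocycle \<open>\<kappa>(a y)\<^sup>-\<^sup>1 a \<kappa>(y)\<close>, where \<open>\<kappa>(y)\<close> carries a base point of the C-orbit of y to y, is
  trivial on the amalgamated part C and makes the factor A act on fibres through \<open>\<theta>\<close>.\<close>
lemma free_extension:
  fixes \<rho> :: "4 \<Rightarrow> 'y::linorder \<Rightarrow> 'y" and \<theta> :: "4 \<Rightarrow> 'a::linorder \<Rightarrow> 'a"
  assumes J: "JA \<union> JB = UNIV" and R: "RA \<subseteq> wd JA" "RB \<subseteq> wd JB"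
    and \<rho>: "oact (RA \<union> RB) \<rho>" and \<theta>: "oact RA \<theta>"
    and fr: "\<And>c y x. c \<in> wd (JA \<inter> JB) \<Longrightarrow> act \<rho> c y = y \<Longrightarrow> act \<theta> c x = x"
    and A: "\<And>w x. w \<in> wd JA \<Longrightarrow> act \<theta> w x = x \<Longrightarrow> eqv (RA \<union> RB) w []"
  obtains \<rho>' :: "4 \<Rightarrow> ('y, 'a) lex \<Rightarrow> ('y, 'a) lex" where "oact (RA \<union> RB) \<rho>'"
    "\<And>w p. lfst (act \<rho>' w p) = act \<rho> w (lfst p)"
    "\<And>w p. w \<in> wd JA \<Longrightarrow> act \<rho>' w p = p \<Longrightarrow> eqv (RA \<union> RB) w []"
proof -
  let ?C = "JA \<inter> JB"
  define rep where "rep y = (SOME z. z \<in> orb ?C \<rho> y)" for y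
  have "\<exists>c. c \<in> wd ?C \<and> act \<rho> c (rep y) = y" for y
  proof -
    have "rep y \<in> orb ?C \<rho> y" unfolding rep_def by (rule someI, rule orb_self)
    then obtain c where "c \<in> wd ?C" "rep y = act \<rho> c y" by (auto simp: orb_def)
    then show ?thesis using \<rho> by (intro exI[of _ "winv c"]) simp
  qed
  then obtain \<kappa> where \<kappa>: "\<And>y. \<kappa> y \<in> wd ?C" "\<And>y. act \<rho> (\<kappa> y) (rep y) = y" by metis
  have fi: "finv (act \<theta> (winv k)) e = act \<theta> k e" for k e
    by (rule finv_eqI) (use \<theta> in \<open>auto intro: oaut_act\<close>)
  obtain \<rho>' :: "4 \<Rightarrow> ('y, 'a) lex \<Rightarrow> ('y, 'a) lex" where \<rho>': "oact (RA \<union> RB) \<rho>'"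
    "\<And>w p. lfst (act \<rho>' w p) = act \<rho> w (lfst p)"
    "\<And>w y e. w \<in> wd JA \<Longrightarrow> act \<rho>' w (Lex y e) = Lex (act \<rho> w y)
       (act \<theta> (winv (\<kappa> (act \<rho> w y))) (act \<theta> w (finv (act \<theta> (winv (\<kappa> y))) e)))"
  proof (rule skew_product[OF J R \<rho> \<theta>, where \<theta>B = "\<lambda>_ x. x" and uB = "\<lambda>_ x. x"
        and uA = "\<lambda>y. act \<theta> (winv (\<kappa> y))"])
    fix i y e assume i: "i \<in> ?C"
    \<comment> \<open>\<open>rep\<close> is constant on C-orbits, so this word fixes the base point.
      By \<open>fr\<close> it then acts trivially through \<open>\<theta>\<close>, which is the
      agreement with the trivial cocycle on shared generators.\<close>
    let ?c = "winv (\<kappa> (\<rho> i y)) @ [(i, False)] @ \<kappa> y"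
    have "rep (\<rho> i y) = rep y"
      using orb_act[OF \<rho>, of "[(i, False)]" ?C y] i by (simp add: rep_def letter_act_def)
    then have "act \<rho> (\<kappa> (\<rho> i y)) (rep y) = \<rho> i y" using \<kappa>(2) by metis
    then have "act \<rho> ?c (rep y) = rep y"
      using act_winv(2)[OF \<rho>, of "\<kappa> (\<rho> i y)" "rep y"] \<kappa>(2)[of y] by (simp add: letter_act_def)
    then have "act \<theta> ?c e = e" using \<kappa>(1) i by (intro fr[of ?c]) auto
    then show "act \<theta> (winv (\<kappa> (\<rho> i y))) (\<theta> i (finv (act \<theta> (winv (\<kappa> y))) e)) = finv (\<lambda>x. x) e"
      by (simp add: fi letter_act_def inv_f_eq)
  qed (use \<theta> in \<open>auto intro: oaut_act simp: oact_def\<close>)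
  show ?thesis
  proof (rule that[OF \<rho>'(1,2)])
    fix w p assume w: "w \<in> wd JA" "act \<rho>' w p = p"
    obtain y e where p: "p = Lex y e" by (cases p)
    have y: "act \<rho> w y = y" and e: "act \<theta> (winv (\<kappa> y)) (act \<theta> w (act \<theta> (\<kappa> y) e)) = e"
      using w \<rho>'(3)[of w y e] by (auto simp: p fi)
    have "act \<theta> w (act \<theta> (\<kappa> y) e) = act \<theta> (\<kappa> y) e"
      using act_winv(1)[OF \<theta>, of "\<kappa> y"] e by metis
    then show "eqv (RA \<union> RB) w []" by (rule A[OF w(1)])
  qed
qed


section \<open>Separating the elements of an amalgam\<close>

text \<open>Letters are added on the left: one joins the leading syllable if the sides agree and
  opens a new syllable otherwise. A syllable that becomes equivalent to a word of the amalgamated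
  part is swallowed by what follows it.\<close>

lemma alternating_form:
  assumes J: "JA \<union> JB = UNIV"
  shows "\<exists>gs c. eqv R w (concat (map snd gs) @ c) \<and> c \<in> wd (JA \<inter> JB) \<and>
    (\<forall>g\<in>set gs. snd g \<in> wd (if fst g then JA else JB) \<and> (\<forall>d\<in>wd (JA \<inter> JB). \<not> eqv R d (snd g))) \<and>
    successively (\<lambda>g h. fst g \<noteq> fst h) gs"
    (is "\<exists>gs c. ?P w gs c")
proof (induction w)
  case Nil show ?case by (intro exI[of _ "[]"]) (auto intro: eqv.refl)
next
  case (Cons l w)
  then obtain gs c where P: "?P w gs c" by blast
  have eq: "eqv R (l # w) (l # concat (map snd gs) @ c)"
    using P eqv_app[of R w _ "[l]" "[]"] by simp
  let ?C = "JA \<inter> JB"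
  \<comment> \<open>a word equivalent to a C-word is absorbed by whatever syllable follows it\<close>
  have absorb: "\<exists>gs c. ?P (l # w) gs c"
    if d: "eqv R u d" "d \<in> wd ?C" and hs: "?P v hs c" "eqv R (l # w) (u @ v)" for u d v hs c
  proof (cases hs)
    case Nil
    have "eqv R (u @ v) (d @ c)" using d hs Nil by (auto intro: eqv_append)
    then have "?P (l # w) [] (d @ c)" using d hs Nil by (auto intro: eqv.trans)
    then show ?thesis by blast
  next
    case (Cons g hs')
    obtain s h where g: "g = (s, h)" by (cases g)
    have "eqv R (u @ v) (d @ concat (map snd hs) @ c)" using d hs by (auto intro: eqv_append)
    then have "eqv R (l # w) (concat (map snd ((s, d @ h) # hs')) @ c)"
      using hs Cons g by (auto intro: eqv.trans)
    moreover have "\<not> eqv R e (d @ h)" if e: "e \<in> wd ?C" for e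
    proof
      assume "eqv R e (d @ h)"
      from eqv_append[OF eqv.refl[of R "winv d"] this] have "eqv R (winv d @ e) (winv d @ d @ h)" by simp
      moreover have "eqv R (winv d @ d @ h) h" using eqv_append[OF eqv_inv_left[of R d] eqv.refl[of R h]] by simp
      ultimately have "eqv R (winv d @ e) h" by (rule eqv.trans)
      moreover have "winv d @ e \<in> wd ?C" using d e by simp
      ultimately show False using hs Cons g by auto
    qed
    moreover have "d \<in> wd JA" "d \<in> wd JB" using d by (auto simp: wd_Int)
    ultimately have "?P (l # w) ((s, d @ h) # hs') c"
      using hs Cons g by (cases hs') (auto split: if_splits)
    then show ?thesis by blast
  qed
  \<comment> \<open>A shared letter may get either side; when it would open a new syllable, it is
    itself a word of the amalgamated part and is absorbed.\<close>
  obtain s where s: "fst l \<in> (if s then JA else JB)" using J by (metis UNIV_I Un_iff)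
  show ?case
  proof (cases "gs \<noteq> [] \<and> fst (hd gs) = s")
    case True
    then obtain h gs' where gs: "gs = (s, h) # gs'" by (cases gs) auto
    show ?thesis
    proof (cases "\<exists>d\<in>wd ?C. eqv R d (l # h)")
      case True
      then obtain d where d: "d \<in> wd ?C" "eqv R (l # h) d" by (auto intro: eqv.sym)
      have "?P (concat (map snd gs') @ c) gs' c" using P gs by (cases gs') (auto intro: eqv.refl)
      then show ?thesis using absorb[OF d(2,1)] eq by (simp add: gs)
    next
      case False
      then have "?P (l # w) ((s, l # h) # gs') c" using P gs s eq by (cases gs') auto
      then show ?thesis by blast
    qed
  next
    case False
    show ?thesis
    proof (cases "\<exists>d\<in>wd ?C. eqv R d [l]")
      case True
      then obtain d where d: "d \<in> wd ?C" "eqv R [l] d" by (auto intro: eqv.sym)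
      then show ?thesis using absorb[OF d(2,1) P] by (simp add: eqv.refl)
    next
      case F: False
      then have "?P (l # w) ((s, [l]) # gs) c" using P s eq False by (cases gs) auto
      then show ?thesis by blast
    qed
  qed
qed

text \<open>Twisting the two factors by gauges that depend only on C-orbits leaves the action of C alone, and
  an alternating word becomes a product of gauges in which consecutive ones differ.\<close>
lemma twist_separates:
  fixes \<rho> :: "4 \<Rightarrow> 'y::linorder \<Rightarrow> 'y"
  assumes J: "JA \<union> JB = UNIV" and R: "RA \<subseteq> wd JA" "RB \<subseteq> wd JB"
    and \<rho>: "oact (RA \<union> RB) \<rho>"
    and A: "\<And>w y. w \<in> wd JA \<Longrightarrow> act \<rho> w y = y \<Longrightarrow> eqv (RA \<union> RB) w []"
    and B: "\<And>w y. w \<in> wd JB \<Longrightarrow> act \<rho> w y = y \<Longrightarrow> eqv (RA \<union> RB) w []"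
    and w: "\<not> eqv (RA \<union> RB) w []"
  shows "\<exists>\<rho>' :: 4 \<Rightarrow> ('y, real) lex \<Rightarrow> ('y, real) lex. oact (RA \<union> RB) \<rho>' \<and> (\<exists>p. act \<rho>' w p \<noteq> p)"
proof -
  let ?R = "RA \<union> RB" and ?C = "JA \<inter> JB"
  obtain gs c where gs: "eqv ?R w (concat (map snd gs) @ c)" "c \<in> wd ?C"
    "\<And>g. g \<in> set gs \<Longrightarrow> snd g \<in> wd (if fst g then JA else JB)"
    "\<And>g d. g \<in> set gs \<Longrightarrow> d \<in> wd ?C \<Longrightarrow> \<not> eqv ?R d (snd g)"
    "successively (\<lambda>g h. fst g \<noteq> fst h) gs"
    using alternating_form[OF J, of ?R w] by blast
  \<comment> \<open>Any base point will do, since both factors have trivial stabilizers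
    everywhere.\<close>
  fix y :: 'y
  let ?o = "orb ?C \<rho>"
  define hs where "hs = rev gs"
  define q where "q n = act \<rho> (concat (map snd (rev (take n hs)))) y" for n
  \<comment> \<open>On fibres the n-th factor, counted from the right, acts as the inverse gauge at
    its source followed by the gauge at its target. Both keys carry the side of the factor, so keys
    change between factors as well.\<close>
  define f where "f n = [((fst (hs ! n), ?o (q n)), True), ((fst (hs ! n), ?o (q (Suc n))), False)]" for n
  define ls where "ls = concat (map f [0..<length hs])"
  have hs_set: "hs ! n \<in> set gs" if "n < length hs" for n
    using nth_mem[OF that] by (simp add: hs_def)
  have q_Suc: "q (Suc n) = act \<rho> (snd (hs ! n)) (q n)" if "n < length hs" for n
    using that by (simp add: q_def take_Suc_conv_app_nth)
  have len: "length ls = 2 * length hs"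
    by (simp add: ls_def f_def length_concat comp_def sum_list_triv)
  have nth: "ls ! (2 * n) = ((fst (hs ! n), ?o (q n)), True)"
    "ls ! Suc (2 * n) = ((fst (hs ! n), ?o (q (Suc n))), False)" if "n < length hs" for n
  proof -
    have "concat (map f [0..<m]) ! (2 * n) = f n ! 0 \<and> concat (map f [0..<m]) ! Suc (2 * n) = f n ! 1" if "n < m" for m
      using that
    proof (induction m)
      case (Suc m)
      have l: "length (concat (map f [0..<m])) = 2 * m" by (simp add: f_def length_concat comp_def sum_list_triv)
      show ?case using Suc l by (cases "n = m") (auto simp: nth_append)
    qed simp
    then show "ls ! (2 * n) = ((fst (hs ! n), ?o (q n)), True)"
      "ls ! Suc (2 * n) = ((fst (hs ! n), ?o (q (Suc n))), False)"
      using that unfolding ls_def by (auto simp: f_def[of n])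
  qed
  \<comment> \<open>Equal orbits would give a word d of the amalgamated part such that d^(-1) g
    fixes a point; freeness makes g equivalent to d, against the alternating form.\<close>
  have orb_ne: "?o (q n) \<noteq> ?o (q (Suc n))" if n: "n < length hs" for n
  proof
    let ?g = "hs ! n"
    have g: "?g \<in> set gs" using hs_set[OF n] .
    assume "?o (q n) = ?o (q (Suc n))"
    then have "act \<rho> (snd ?g) (q n) \<in> ?o (q n)" using orb_self q_Suc[OF n] by metis
    then obtain d where d: "d \<in> wd ?C" "act \<rho> (snd ?g) (q n) = act \<rho> d (q n)" by (auto simp: orb_def)
    have "act \<rho> (winv d @ snd ?g) (q n) = q n" using d \<rho> by simp
    moreover have "winv d @ snd ?g \<in> wd (if fst ?g then JA else JB)"
      using gs(3)[OF g] d(1) by (auto simp: wd_Int)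
    ultimately have "eqv ?R (winv d @ snd ?g) []" using A B by (auto split: if_splits)
    then show False using gs(4)[OF g d(1)] eqv_iff by blast
  qed
  have alt: "fst (hs ! n) \<noteq> fst (hs ! Suc n)" if "Suc n < length hs" for n
    using gs(5) that unfolding hs_def successively_conv_nth
    by (metis (no_types, lifting) Suc_lessD hs_def length_rev rev_nth diff_Suc_less Suc_diff_Suc length_greater_0_conv)
  have "fst (ls ! i) \<noteq> fst (ls ! Suc i)" if "Suc i < length ls" for i
  proof (cases "even i")
    case True
    then obtain n where "i = 2 * n" by blast
    then show ?thesis using nth[of n] orb_ne[of n] that len by auto
  next
    case False
    then obtain n where "i = Suc (2 * n)" by (metis oddE Suc_eq_plus1)
    then show ?thesis using nth(2)[of n] nth(1)[of "Suc n"] alt[of n] that len by auto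
  qed
  from upward_path[OF this] obtain M :: "bool \<times> 'y set \<Rightarrow> real \<Rightarrow> real" where M: "\<And>k. oaut (M k)"
    "\<And>i. i < length ls \<Longrightarrow> (if snd (ls ! i) then finv (M (fst (ls ! i))) else M (fst (ls ! i))) (real i) = real (Suc i)"
    by blast
  have M_step: "M (fst (hs ! n), ?o (q (Suc n))) (finv (M (fst (hs ! n), ?o (q n))) (real (2 * n))) = real (2 * Suc n)"
    if "n < length hs" for n
    using M(2)[of "2 * n"] M(2)[of "Suc (2 * n)"] nth[OF that] that len by simp
  obtain \<rho>' :: "4 \<Rightarrow> ('y, real) lex \<Rightarrow> ('y, real) lex" where \<rho>': "oact ?R \<rho>'"
    "\<And>w p. lfst (act \<rho>' w p) = act \<rho> w (lfst p)"
    "\<And>w y e. w \<in> wd JA \<Longrightarrow> act \<rho>' w (Lex y e) = Lex (act \<rho> w y)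
       (M (True, ?o (act \<rho> w y)) (act (\<lambda>_ x. x) w (finv (M (True, ?o y)) e)))"
    "\<And>w y e. w \<in> wd JB \<Longrightarrow> act \<rho>' w (Lex y e) = Lex (act \<rho> w y)
       (M (False, ?o (act \<rho> w y)) (act (\<lambda>_ x. x) w (finv (M (False, ?o y)) e)))"
  proof (rule skew_product[OF J R \<rho>, where \<theta>A = "\<lambda>_ x. x" and \<theta>B = "\<lambda>_ x. x" and
        uA = "\<lambda>y. M (True, ?o y)" and uB = "\<lambda>y. M (False, ?o y)"])
    fix i y e assume "i \<in> ?C"
    then have "?o (\<rho> i y) = ?o y" using orb_act[OF \<rho>, of "[(i, False)]" ?C y] by (simp add: letter_act_def)
    then show "M (True, ?o (\<rho> i y)) (finv (M (True, ?o y)) e) = M (False, ?o (\<rho> i y)) (finv (M (False, ?o y)) e)"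
      using M(1) by simp
  qed (use M(1) in \<open>auto simp: oact_def\<close>)
  have C: "act \<rho>' c (Lex y e) = Lex (act \<rho> c y) e" for y e
    using \<rho>'(3)[of c y e] gs(2) orb_act[OF \<rho> gs(2), of y] M(1) by (simp add: wd_Int)
  have step: "act \<rho>' (concat (map snd (rev (take n hs)))) (Lex y 0) = Lex (q n) (real (2 * n))"
    if "n \<le> length hs" for n using that
  proof (induction n)
    case 0 then show ?case by (simp add: q_def)
  next
    case (Suc n)
    have "snd (hs ! n) \<in> wd (if fst (hs ! n) then JA else JB)" using gs(3)[OF hs_set] Suc(2) by simp
    then have "act \<rho>' (snd (hs ! n)) (Lex (q n) (real (2 * n))) = Lex (q (Suc n)) (real (2 * Suc n))"
      using \<rho>'(3,4)[of "snd (hs ! n)"] M_step[of n] q_Suc[of n] Suc(2) by (auto split: if_splits)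
    then show ?case using Suc by (simp add: take_Suc_conv_app_nth)
  qed
  \<comment> \<open>\<open>c\<close> leaves fibre coordinates alone and carries this point to
    \<open>Lex y 0\<close>, where the upward path starts.\<close>
  let ?p = "Lex (act \<rho> (winv c) y) (0 :: real)"
  have eq: "act \<rho>' w ?p = Lex (q (length hs)) (real (2 * length hs))"
    using act_eqv[OF gs(1) \<rho>'(1), of ?p] step[of "length hs"] \<rho> by (simp add: C hs_def)
  have "act \<rho>' w ?p \<noteq> ?p"
  \<comment> \<open>Without factors the base coordinate moves, because \<open>c\<close> acts freely;
    otherwise the fibre coordinate rises from 0 to \<open>2 * length hs\<close>.\<close>
  proof (cases "hs = []")
    case True
    then have wc: "eqv ?R w c" using gs(1) by (simp add: hs_def)
    show ?thesis
    proof
      assume "act \<rho>' w ?p = ?p"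
      then have "act \<rho> w (lfst ?p) = lfst ?p" using \<rho>'(2) by metis
      then have "act \<rho> c (lfst ?p) = lfst ?p" using act_eqv[OF wc \<rho>] by metis
      then have "eqv ?R c []" using A[of c] gs(2) by (simp only: wd_Int)
      then show False using w wc eqv.trans by blast
    qed
  qed (simp add: eq)
  then show ?thesis using \<rho>'(1) by blast
qed

text \<open>Freeness gained for the first factor survives the extension for the second, because
  projection to the base is equivariant. The freeness of the amalgamated part enters as
  \<open>frA\<close> and \<open>frB\<close>: whatever fixes a base point acts trivially on the
  fibres.\<close>

theorem amalgam_separated:
  fixes \<rho> :: "4 \<Rightarrow> 'y::linorder \<Rightarrow> 'y" and \<theta>A :: "4 \<Rightarrow> 'a::linorder \<Rightarrow> 'a" and \<theta>B :: "4 \<Rightarrow> 'b::linorder \<Rightarrow> 'b"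
  assumes J: "JA \<union> JB = UNIV" and R: "RA \<subseteq> wd JA" "RB \<subseteq> wd JB" "R = RA \<union> RB"
    and \<rho>: "oact R \<rho>" and \<theta>: "oact RA \<theta>A" "oact RB \<theta>B"
    and frA: "\<And>c y x. c \<in> wd (JA \<inter> JB) \<Longrightarrow> act \<rho> c y = y \<Longrightarrow> act \<theta>A c x = x"
    and frB: "\<And>c y x. c \<in> wd (JA \<inter> JB) \<Longrightarrow> act \<rho> c y = y \<Longrightarrow> act \<theta>B c x = x"
    and A: "\<And>w x. w \<in> wd JA \<Longrightarrow> act \<theta>A w x = x \<Longrightarrow> eqv R w []"
    and B: "\<And>w x. w \<in> wd JB \<Longrightarrow> act \<theta>B w x = x \<Longrightarrow> eqv R w []"
    and w: "\<not> eqv R w []"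
  shows "\<exists>\<rho>' :: 4 \<Rightarrow> ((('y, 'a) lex, 'b) lex, real) lex \<Rightarrow> _. oact R \<rho>' \<and> (\<exists>p. act \<rho>' w p \<noteq> p)"
proof -
  obtain \<rho>1 :: "4 \<Rightarrow> ('y, 'a) lex \<Rightarrow> ('y, 'a) lex" where 1: "oact R \<rho>1"
    "\<And>w p. lfst (act \<rho>1 w p) = act \<rho> w (lfst p)"
    "\<And>w p. w \<in> wd JA \<Longrightarrow> act \<rho>1 w p = p \<Longrightarrow> eqv R w []"
    unfolding R(3)
  proof (rule free_extension[OF J R(1,2) \<rho>[unfolded R(3)] \<theta>(1)])
    show "act \<theta>A c x = x" if "c \<in> wd (JA \<inter> JB)" "act \<rho> c y = y" for c y x using frA that .
    show "eqv (RA \<union> RB) w []" if "w \<in> wd JA" "act \<theta>A w x = x" for w x using A that unfolding R(3) .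
  qed blast
  have frB': "act \<theta>B c x = x" if "c \<in> wd (JB \<inter> JA)" "act \<rho>1 c p = p" for c x p
    using frB[of c "lfst p" x] that 1(2)[of c p] by (simp add: Int_commute)
  have R': "R = RB \<union> RA" and J': "JB \<union> JA = UNIV" using R J by auto
  obtain \<rho>2 :: "4 \<Rightarrow> (('y, 'a) lex, 'b) lex \<Rightarrow> (('y, 'a) lex, 'b) lex" where 2: "oact R \<rho>2"
    "\<And>w p. lfst (act \<rho>2 w p) = act \<rho>1 w (lfst p)"
    "\<And>w p. w \<in> wd JB \<Longrightarrow> act \<rho>2 w p = p \<Longrightarrow> eqv R w []"
    unfolding R'
  proof (rule free_extension[OF J' R(2,1) 1(1)[unfolded R'] \<theta>(2)])
    show "act \<theta>B c x = x" if "c \<in> wd (JB \<inter> JA)" "act \<rho>1 c y = y" for c y x using frB' that .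
    show "eqv (RB \<union> RA) w []" if "w \<in> wd JB" "act \<theta>B w x = x" for w x using B that unfolding R' .
  qed blast
  have "eqv R w []" if "w \<in> wd JA" "act \<rho>2 w p = p" for w p
    using 1(3)[of w "lfst p"] 2(2)[of w p] that by metis
  then show ?thesis using twist_separates[OF J R(1,2) 2(1)[unfolded R(3)]] 2(3) w unfolding R(3) by blast
qed

section \<open>Left orders from separating actions\<close>

text \<open>Orders live on words and respect \<open>eqv\<close>, because a type of group elements
  cannot depend on the set \<open>R\<close>.\<close>

definition word_order :: "hword set \<Rightarrow> (hword \<Rightarrow> hword \<Rightarrow> bool) \<Rightarrow> bool" where
  "word_order R lt \<longleftrightarrow> (\<forall>u v. lt u v \<longrightarrow> \<not> eqv R u v) \<and> (\<forall>u v. eqv R u v \<or> lt u v \<or> lt v u) \<and>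
     (\<forall>u v w. lt u v \<longrightarrow> lt v w \<longrightarrow> lt u w) \<and> (\<forall>x u v. lt u v \<longrightarrow> lt (x @ u) (x @ v)) \<and>
     (\<forall>u u' v v'. eqv R u u' \<longrightarrow> eqv R v v' \<longrightarrow> lt u v \<longrightarrow> lt u' v')"

lemma first_difference_less_trans:
  fixes f :: "nat \<Rightarrow> 'a::linorder"
  assumes "\<forall>m<i. f m = g m" "f i < g i" "\<forall>m<j. g m = h m" "g j < h j"
  shows "\<exists>n. (\<forall>m<n. f m = h m) \<and> f n < h n"
  using assms by (intro exI[of _ "min i j"]) (cases i j rule: linorder_cases, auto)

text \<open>There are countably many words. Each gets an action and a point, which it moves if it is
  nontrivial, and u and v are compared at the first index where their images differ. Left
  multiplication applies an order automorphism at each index, so it keeps ties and the first strict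
  inequality. Inequivalent u and v differ at the index of u^(-1) v.\<close>

lemma separated_order:
  assumes sep: "\<And>w. \<not> eqv R w [] \<Longrightarrow> \<exists>\<rho> :: 4 \<Rightarrow> 't::linorder \<Rightarrow> 't. oact R \<rho> \<and> (\<exists>p. act \<rho> w p \<noteq> p)"
  shows "\<exists>lt. word_order R lt"
proof -
  have "\<forall>w. \<exists>q :: (4 \<Rightarrow> 't \<Rightarrow> 't) \<times> 't. oact R (fst q) \<and> (\<not> eqv R w [] \<longrightarrow> act (fst q) w (snd q) \<noteq> snd q)"
  proof
    fix w
    have "oact R (\<lambda>_ x. x :: 't)" by (simp add: oact_def)
    then show "\<exists>q :: (4 \<Rightarrow> 't \<Rightarrow> 't) \<times> 't. oact R (fst q) \<and> (\<not> eqv R w [] \<longrightarrow> act (fst q) w (snd q) \<noteq> snd q)"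
      using sep[of w] by (cases "eqv R w []") fastforce+
  qed
  from choice[OF this] obtain q :: "hword \<Rightarrow> (4 \<Rightarrow> 't \<Rightarrow> 't) \<times> 't" where
    q: "\<And>w. oact R (fst (q w))" "\<And>w. \<not> eqv R w [] \<Longrightarrow> act (fst (q w)) w (snd (q w)) \<noteq> snd (q w)" by blast
  define val where "val n u = act (fst (q (from_nat n))) u (snd (q (from_nat n)))" for n u
  define lt where "lt u v \<longleftrightarrow> (\<exists>n. (\<forall>m<n. val m u = val m v) \<and> val n u < val n v)" for u v
  have eq: "val n u = val n v" if "eqv R u v" for n u v
    unfolding val_def by (rule act_eqv[OF that q(1)])
  have app: "val n (x @ u) = act (fst (q (from_nat n))) x (val n u)" for n x u
    by (simp add: val_def)
  have ne: "\<exists>n. val n u \<noteq> val n v" if "\<not> eqv R u v" for u v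
  proof
    let ?w = "winv u @ v"
    have "act (fst (q ?w)) ?w (snd (q ?w)) \<noteq> snd (q ?w)" using q(2)[of ?w] that eqv_iff by blast
    then show "val (to_nat ?w) u \<noteq> val (to_nat ?w) v"
      unfolding val_def using act_winv(2)[OF q(1)[of ?w], of u "snd (q ?w)"] by auto
  qed
  show ?thesis unfolding word_order_def
  proof (intro exI[of _ lt] conjI allI impI)
    show "eqv R u v \<or> lt u v \<or> lt v u" for u v
    proof (cases "eqv R u v")
      case False
      define n where "n = (LEAST n. val n u \<noteq> val n v)"
      have "val n u \<noteq> val n v" "\<forall>m<n. val m u = val m v"
        using LeastI_ex[OF ne[OF False]] not_less_Least unfolding n_def by blast+
      then have "val n u < val n v \<or> val n v < val n u" "\<forall>m<n. val m v = val m u" by auto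
      with \<open>\<forall>m<n. val m u = val m v\<close> show ?thesis unfolding lt_def by blast
    qed simp
    show "\<not> eqv R u v" if "lt u v" for u v using that eq[of u v] by (auto simp: lt_def)
    show "lt u w" if "lt u v" "lt v w" for u v w
    proof -
      from that obtain i j where "\<forall>m<i. val m u = val m v" "val i u < val i v"
        "\<forall>m<j. val m v = val m w" "val j v < val j w" unfolding lt_def by blast
      then show ?thesis unfolding lt_def by (rule first_difference_less_trans)
    qed
    show "lt (x @ u) (x @ v)" if "lt u v" for x u v
    proof -
      from that obtain n where "\<forall>m<n. val m u = val m v" "val n u < val n v" unfolding lt_def by blast
      then show ?thesis unfolding lt_def
        by (intro exI[of _ n]) (simp add: app oaut_less[OF oaut_act[OF q(1)]])
    qed
    show "lt u' v'" if "eqv R u u'" "eqv R v v'" "lt u v" for u u' v v'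
      using that eq[of u u'] eq[of v v'] by (simp add: lt_def)
  qed
qed

lemma word_orderD:
  assumes "word_order R lt"
  shows "lt u v \<Longrightarrow> \<not> eqv R u v" "eqv R u v \<or> lt u v \<or> lt v u" "lt u v \<Longrightarrow> lt v w \<Longrightarrow> lt u w"
    "lt u v \<Longrightarrow> lt (x @ u) (x @ v)" "lt u v \<Longrightarrow> eqv R u u' \<Longrightarrow> eqv R v v' \<Longrightarrow> lt u' v'"
proof -
  note w = assms[unfolded word_order_def]
  show "lt u v \<Longrightarrow> \<not> eqv R u v" using conjunct1[OF w] by blast
  note w = conjunct2[OF w]
  show "eqv R u v \<or> lt u v \<or> lt v u" using conjunct1[OF w] by blast
  note w = conjunct2[OF w]
  show "lt u v \<Longrightarrow> lt v w \<Longrightarrow> lt u w" using conjunct1[OF w] by blast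
  note w = conjunct2[OF w]
  show "lt u v \<Longrightarrow> lt (x @ u) (x @ v)" using conjunct1[OF w] by blast
  show "lt u v \<Longrightarrow> eqv R u u' \<Longrightarrow> eqv R v v' \<Longrightarrow> lt u' v'" using conjunct2[OF w] by blast
qed

section \<open>The quotient group, its order and its left regular action\<close>

lemma quotient_order:
  fixes cls :: "hword \<Rightarrow> 'g"
  assumes lt: "word_order R lt" and cls: "\<And>u v. cls u = cls v \<longleftrightarrow> eqv R u v" "surj cls"
    and lg: "\<And>x y. lg x y \<longleftrightarrow> (\<exists>u v. x = cls u \<and> y = cls v \<and> lt u v)"
  shows "lg (cls u) (cls v) \<longleftrightarrow> lt u v" "\<not> lg x x" "lg x y \<Longrightarrow> lg y z \<Longrightarrow> lg x z"
    "x = y \<or> lg x y \<or> lg y x"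
proof -
  have *: "lg (cls u) (cls v) \<longleftrightarrow> lt u v" for u v
    unfolding lg cls using word_orderD(5)[OF lt] eqv.sym eqv.refl by blast
  then show "lg (cls u) (cls v) \<longleftrightarrow> lt u v" .
  obtain a b c where [simp]: "x = cls a" "y = cls b" "z = cls c" using cls(2) by (meson surjD)
  show "\<not> lg x x" using word_orderD(1)[OF lt, of a a] by (auto simp: * eqv.refl)
  show "lg x y \<Longrightarrow> lg y z \<Longrightarrow> lg x z" using word_orderD(3)[OF lt, of a b c] by (simp add: *)
  show "x = y \<or> lg x y \<or> lg y x" using word_orderD(2)[OF lt, of a b] by (simp add: * cls)
qed

lemma quotient_action:
  fixes cls :: "hword \<Rightarrow> 'g::linorder"
  assumes lt: "word_order R lt" and cls: "\<And>u v. cls u = cls v \<longleftrightarrow> eqv R u v" "surj cls"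
    and less: "\<And>u v. cls u < cls v \<longleftrightarrow> lt u v"
  obtains \<theta> where "oact R \<theta>" "\<And>w v. act \<theta> w (cls v) = cls (w @ v)"
proof -
  define \<theta> where "\<theta> i x = cls ((i, False) # (SOME v. cls v = x))" for i x
  have \<theta>: "\<theta> i (cls v) = cls ((i, False) # v)" for i v
  proof -
    have "cls (SOME u. cls u = cls v) = cls v" by (rule someI) simp
    then show ?thesis unfolding \<theta>_def cls using eqv_app[of R _ v "[(i, False)]" "[]"] by simp
  qed
  have o: "oaut (\<theta> i)" for i
  proof (rule oautI)
    show "strict_mono (\<theta> i)"
    proof (rule strict_monoI)
      fix x y :: 'g assume "x < y"
      moreover obtain u v where uv: "x = cls u" "y = cls v" using cls(2) by (meson surjD)
      ultimately have "lt ([(i, False)] @ u) ([(i, False)] @ v)" using less word_orderD(4)[OF lt] by blast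
      then show "\<theta> i x < \<theta> i y" by (simp add: uv \<theta> less)
    qed
    fix x
    obtain u where u: "x = cls u" using cls(2) by (meson surjD)
    have "cls ([(i, False), inv_letter (i, False)] @ u) = cls u"
      unfolding cls using eqv.cancel[of R "[]" "(i, False)" u] by simp
    then show "\<theta> i (cls ((i, True) # (SOME u. cls u = x))) = x"
      unfolding \<theta> using someI[of "\<lambda>u. cls u = x" u] u eqv_app[of R _ u "[(i, False), (i, True)]" "[]"]
      by (simp add: cls inv_letter_def) (metis eqv.trans)
  qed
  have inv: "finv (\<theta> i) (cls v) = cls ((i, True) # v)" for i v
  proof (rule finv_eqI[OF o])
    show "\<theta> i (cls ((i, True) # v)) = cls v"
      unfolding \<theta> cls using eqv.cancel[of R "[]" "(i, False)" v] by (simp add: inv_letter_def)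
  qed
  have act: "act \<theta> w (cls v) = cls (w @ v)" for w v
    by (induction w) (auto simp: letter_act_def \<theta> inv)
  have "act \<theta> r x = x" if "r \<in> R" for r x
  proof -
    obtain u where "x = cls u" using cls(2) by (meson surjD)
    then show ?thesis using eqv.rel[OF that, of "[]" u] by (simp add: act cls)
  qed
  then show ?thesis using that[of \<theta>] o act by (simp add: oact_def)
qed

section \<open>Baumslag-Solitar groups\<close>

text \<open>The affine action of the Baumslag-Solitar group has fixed points, such as 0 for the
  dilation. The second coordinate counts the exponent of the dilation and removes them.\<close>

definition bs :: "4 \<Rightarrow> 4 \<Rightarrow> (real, real) lex \<Rightarrow> (real, real) lex" where
  "bs i j p = (if j = i then Lex (2 * lfst p) (lsnd p + 1)
     else if j = i + 1 then Lex (lfst p + 1) (lsnd p) else p)"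

lemma oaut_scaling: "c > 0 \<Longrightarrow> oaut (\<lambda>x. c * x)" for c :: real
  by (rule oautI[where g = "\<lambda>x. x / c"]) (auto intro: strict_monoI)

lemma oaut_bs: "oaut (bs i j)"
proof -
  consider "j = i" | "j \<noteq> i" "j = i + 1" | "j \<noteq> i" "j \<noteq> i + 1" by blast
  then show ?thesis
  proof cases
    case 1
    show ?thesis by (rule oaut_lexI[OF oaut_scaling[of 2] oaut_translation[of 1]]) (auto simp: bs_def 1)
  next
    case 2
    show ?thesis by (rule oaut_lexI[OF oaut_translation[of 1] oaut_id(2)]) (use 2 in \<open>auto simp: bs_def\<close>)
  next
    case 3
    then have "bs i j = (\<lambda>p. p)" by (auto simp: bs_def)
    then show ?thesis by simp
  qed
qed

lemma finv_bs: "finv (bs i j) p = (if j = i then Lex (lfst p / 2) (lsnd p - 1)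
     else if j = i + 1 then Lex (lfst p - 1) (lsnd p) else p)"
  by (rule finv_eqI[OF oaut_bs]) (auto simp: bs_def lex.expand)

lemma plus1_neq [simp]: "i + 1 \<noteq> i" "i \<noteq> i + 1" for i :: 4
  by auto

lemma bs_relator: "act (bs i) (higman_relator i) p = p"
  by (rule oact_relatorI[where \<rho> = "bs i"]) (auto simp: oaut_bs bs_def)

section \<open>Normal forms in Baumslag-Solitar groups\<close>

definition bpow :: "4 \<Rightarrow> int \<Rightarrow> hword" where
  "bpow j m = replicate (nat \<bar>m\<bar>) (j, m < 0)"

lemma bpow_neg: "bpow j (- int n) = replicate n (j, True)"
  by (cases n) (auto simp: bpow_def nat_add_distrib)

lemma eqv_bpow_Suc: "eqv R ((j, False) # bpow j m) (bpow j (m + 1))"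
proof (cases "m < 0")
  case True
  define n where "n = nat (- m - 1)"
  have m: "m = - int (Suc n)" "m + 1 = - int n" using True by (simp_all add: n_def)
  have "bpow j m = (j, True) # bpow j (m + 1)"
    unfolding m(2) unfolding m(1) by (simp only: bpow_neg replicate_Suc)
  then show ?thesis using eqv.cancel[of R "[]" "(j, False)" "bpow j (m + 1)"] by (simp add: inv_letter_def)
next
  case False
  then have "(j, False) # bpow j m = bpow j (m + 1)" by (simp add: bpow_def nat_add_distrib)
  then show ?thesis by (simp add: eqv.refl)
qed

lemma eqv_bpow_pred: "eqv R ((j, True) # bpow j m) (bpow j (m - 1))"
proof -
  have "eqv R ((j, True) # (j, False) # bpow j (m - 1)) ((j, True) # bpow j m)"
    using eqv_app[OF eqv_bpow_Suc[of R j "m - 1"], of "[(j, True)]" "[]"] by simp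
  moreover have "eqv R ((j, True) # (j, False) # bpow j (m - 1)) (bpow j (m - 1))"
    using eqv.cancel[of R "[]" "(j, True)"] by (simp add: inv_letter_def)
  ultimately show ?thesis by (blast intro: eqv.trans eqv.sym)
qed

lemma bpow_simps: "bpow j 0 = []" "m > 0 \<Longrightarrow> bpow j m = (j, False) # bpow j (m - 1)"
  "m < 0 \<Longrightarrow> bpow j m = (j, True) # bpow j (m + 1)"
proof -
  show "m > 0 \<Longrightarrow> bpow j m = (j, False) # bpow j (m - 1)"
    by (cases "nat m") (auto simp: bpow_def nat_diff_distrib)
  assume "m < 0"
  from \<open>m < 0\<close> have "m = - int (Suc (nat (- m - 1)))" by simp
  then obtain n where n: "m = - int (Suc n)" by blast
  then have "m + 1 = - int n" by simp
  then show "bpow j m = (j, True) # bpow j (m + 1)" unfolding n by (simp only: bpow_neg replicate_Suc)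
qed (simp add: bpow_def)

lemma eqv_bpow_add: "eqv R (bpow j m @ bpow j n) (bpow j (m + n))"
proof (induction m rule: int_induct[where k = 0])
  case base show ?case by (simp add: bpow_simps eqv.refl)
next
  case (step1 i)
  have "eqv R ((j, False) # bpow j i @ bpow j n) ((j, False) # bpow j (i + n))"
    using eqv_app[OF step1(2), of "[(j, False)]" "[]"] by simp
  then show ?case using eqv_bpow_Suc[of R j "i + n"] step1(1)
    by (simp add: bpow_simps(2) add.commute add.left_commute) (blast intro: eqv.trans)
next
  case (step2 i)
  have "eqv R ((j, True) # bpow j i @ bpow j n) ((j, True) # bpow j (i + n))"
    using eqv_app[OF step2(2), of "[(j, True)]" "[]"] by simp
  then show ?case using eqv_bpow_pred[of R j "i + n"] step2(1)
    by (simp add: bpow_simps(3) diff_add_eq) (blast intro: eqv.trans)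
qed

lemma eqv_relator:
  assumes "higman_relator i \<in> R"
  shows "eqv R [(i, False), (i + 1, False)] [(i + 1, False), (i + 1, False), (i, False)]"
proof -
  have w: "eqv R (higman_relator i) []" using eqv.rel[OF assms, of "[]" "[]"] by simp
  let ?v = "[(i + 1, False), (i + 1, False), (i, False)]"
  have 1: "eqv R ([(i, False), (i + 1, False)] @ winv ?v @ ?v) ?v"
    using eqv_append[OF w eqv.refl[of R ?v]] by (simp add: higman_relator_def inv_letter_def)
  have 2: "eqv R ([(i, False), (i + 1, False)] @ winv ?v @ ?v) ([(i, False), (i + 1, False)] @ [])"
    by (rule eqv_append[OF eqv.refl eqv_inv_left])
  show ?thesis using eqv.trans[OF eqv.sym[OF 2] 1] by simp
qed

lemma eqv_a_bpow:
  assumes R: "higman_relator i \<in> R"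
  shows "eqv R ((i, False) # bpow (i + 1) m) (bpow (i + 1) (2 * m) @ [(i, False)])"
proof (induction m rule: int_induct[where k = 0])
  case base show ?case by (simp add: bpow_simps eqv.refl)
next
  case (step1 m)
  let ?a = "(i, False)" and ?b = "(i + 1, False)"
  have "eqv R ([?a, ?b] @ bpow (i + 1) m) ([?b, ?b, ?a] @ bpow (i + 1) m)"
    by (intro eqv_append eqv_relator R eqv.refl)
  moreover have "eqv R ([?b, ?b] @ [?a] @ bpow (i + 1) m) ([?b, ?b] @ bpow (i + 1) (2 * m) @ [?a])"
    using eqv_app[OF step1(2), of "[?b, ?b]" "[]"] by simp
  ultimately have "eqv R ([?a, ?b] @ bpow (i + 1) m) ([?b, ?b] @ bpow (i + 1) (2 * m) @ [?a])"
    by (simp only: append.simps) (rule eqv.trans)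
  moreover have "[?a, ?b] @ bpow (i + 1) m = ?a # bpow (i + 1) (m + 1)"
    "[?b, ?b] @ bpow (i + 1) (2 * m) @ [?a] = bpow (i + 1) (2 * (m + 1)) @ [?a]"
    using step1 by (simp_all add: bpow_simps(2))
  ultimately show ?case by (simp only:)
next
  case (step2 m)
  let ?a = "(i, False)" and ?b = "(i + 1, False)" and ?c = "bpow (i + 1) (m - 1)"
  have m: "bpow (i + 1) (m - 1) = (i + 1, True) # bpow (i + 1) m"
    "bpow (i + 1) (2 * (m - 1)) = [(i + 1, True), (i + 1, True)] @ bpow (i + 1) (2 * m)"
    using step2(1) by (simp_all add: bpow_simps(3))
  \<comment> \<open>both sides agree after multiplication by \<open>b\<^sup>2\<close>\<close>
  have "eqv R ([?b, ?b, ?a] @ ?c) ([?a, ?b] @ ?c)"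
    by (intro eqv_append eqv.refl eqv.sym[OF eqv_relator[OF R]])
  moreover have "eqv R ([?a] @ ?b # ?c) ([?a] @ bpow (i + 1) m)"
    by (intro eqv_append eqv.refl) (use eqv_bpow_Suc[of R "i + 1" "m - 1"] in simp)
  ultimately have "eqv R ([?b, ?b] @ ?a # ?c) (bpow (i + 1) (2 * m) @ [?a])"
    using step2(2) by simp (blast intro: eqv.trans)
  from eqv_append[OF eqv.refl this]
  have "eqv R (winv [?b, ?b] @ [?b, ?b] @ ?a # ?c) (winv [?b, ?b] @ bpow (i + 1) (2 * m) @ [?a])" .
  moreover have "eqv R ((winv [?b, ?b] @ [?b, ?b]) @ ?a # ?c) ([] @ ?a # ?c)"
    by (intro eqv_append eqv.refl eqv_inv_left)
  ultimately have "eqv R (?a # ?c) (winv [?b, ?b] @ bpow (i + 1) (2 * m) @ [?a])"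
    by simp (blast intro: eqv.trans eqv.sym)
  then show ?case unfolding m by (simp add: inv_letter_def)
qed

lemma eqv_apow_bpow:
  assumes R: "higman_relator i \<in> R"
  shows "eqv R (replicate k (i, False) @ bpow (i + 1) m) (bpow (i + 1) (2 ^ k * m) @ replicate k (i, False))"
proof (induction k)
  case (Suc k)
  let ?a = "(i, False)"
  have "eqv R ([?a] @ replicate k ?a @ bpow (i + 1) m) ([?a] @ bpow (i + 1) (2 ^ k * m) @ replicate k ?a)"
    by (intro eqv_append eqv.refl Suc)
  moreover have "eqv R ((?a # bpow (i + 1) (2 ^ k * m)) @ replicate k ?a)
     ((bpow (i + 1) (2 * (2 ^ k * m)) @ [?a]) @ replicate k ?a)"
    by (intro eqv_append eqv.refl eqv_a_bpow R)
  ultimately show ?case by (simp add: mult.assoc) (blast intro: eqv.trans)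
qed (simp add: eqv.refl)

text \<open>Every element is a^(-k) b^m a^n. Keeping a^k on the left-hand side avoids division: an
  inverse letter a is cancelled by raising k, and b^e passes a^k as b^(2^k e).\<close>

lemma bs_normal_form:
  assumes R: "higman_relator i \<in> R" and w: "w \<in> wd {i, i + 1}"
  shows "\<exists>k m n. eqv R (replicate k (i, False) @ w) (bpow (i + 1) m @ replicate n (i, False))"
  using w
proof (induction w)
  case Nil show ?case by (intro exI[of _ 0]) (simp add: bpow_simps eqv.refl)
next
  case (Cons l w)
  let ?a = "(i, False)"
  from Cons obtain k m n where IH: "eqv R (replicate k ?a @ w) (bpow (i + 1) m @ replicate n ?a)" by auto
  consider "l = ?a" | "l = (i, True)" | s where "l = (i + 1, s)" using Cons(2) by (cases l) auto
  then show ?case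
  proof cases
    case 1
    have "eqv R ([?a] @ replicate k ?a @ w) ([?a] @ bpow (i + 1) m @ replicate n ?a)"
      by (intro eqv_append eqv.refl IH)
    moreover have "eqv R ((?a # bpow (i + 1) m) @ replicate n ?a) ((bpow (i + 1) (2 * m) @ [?a]) @ replicate n ?a)"
      by (intro eqv_append eqv.refl eqv_a_bpow R)
    ultimately have "eqv R (replicate k ?a @ l # w) (bpow (i + 1) (2 * m) @ replicate (Suc n) ?a)"
      by (simp add: 1 replicate_app_Cons_same) (blast intro: eqv.trans)
    then show ?thesis by blast
  next
    case 2
    have "eqv R (replicate k ?a @ [?a, inv_letter ?a] @ w) (replicate k ?a @ w)" by (rule eqv.cancel)
    then have "eqv R (replicate (Suc k) ?a @ l # w) (bpow (i + 1) m @ replicate n ?a)"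
      using IH by (simp add: 2 inv_letter_def replicate_app_Cons_same) (blast intro: eqv.trans)
    then show ?thesis by blast
  next
    case 3
    define e :: int where "e = (if s then -1 else 1)"
    have l: "[l] = bpow (i + 1) e" by (simp add: 3 e_def bpow_def)
    have "eqv R ((replicate k ?a @ [l]) @ w) ((bpow (i + 1) (2 ^ k * e) @ replicate k ?a) @ w)"
      unfolding l by (intro eqv_append eqv.refl eqv_apow_bpow R)
    moreover have "eqv R (bpow (i + 1) (2 ^ k * e) @ replicate k ?a @ w)
       (bpow (i + 1) (2 ^ k * e) @ bpow (i + 1) m @ replicate n ?a)"
      by (intro eqv_append eqv.refl IH)
    moreover have "eqv R ((bpow (i + 1) (2 ^ k * e) @ bpow (i + 1) m) @ replicate n ?a)
       (bpow (i + 1) (2 ^ k * e + m) @ replicate n ?a)"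
      by (intro eqv_append eqv.refl eqv_bpow_add)
    ultimately have "eqv R (replicate k ?a @ l # w) (bpow (i + 1) (2 ^ k * e + m) @ replicate n ?a)"
      by simp (blast intro: eqv.trans)
    then show ?thesis by blast
  qed
qed

lemma act_bs_apow: "act (bs i) (replicate k (i, False)) (Lex r s) = Lex (2 ^ k * r) (s + k)"
  by (induction k) (auto simp: letter_act_def bs_def)

lemma act_bs_bpow: "act (bs i) (bpow (i + 1) m) (Lex r s) = Lex (r + m) s"
proof -
  have "act (bs i) (replicate n (i + 1, b)) (Lex r s) = Lex (r + (if b then - real n else real n)) s" for n b
    by (induction n) (auto simp: letter_act_def finv_bs, auto simp: bs_def)
  then show ?thesis by (auto simp: bpow_def)
qed

text \<open>One fixed point suffices: in the normal form, second coordinates give k = n, and first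
  coordinates then give m = 0.\<close>

lemma bs_free:
  assumes R: "higman_relator i \<in> R" and w: "w \<in> wd {i, i + 1}" and p: "act (bs i) w p = p"
  shows "eqv R w []"
proof -
  let ?a = "\<lambda>k. replicate k (i, False)"
  \<comment> \<open>The normal form is derived from this relator alone, since \<open>bs i\<close>
    need not satisfy the other elements of \<open>R\<close>.\<close>
  obtain k m n where e: "eqv {higman_relator i} (?a k @ w) (bpow (i + 1) m @ ?a n)"
    using bs_normal_form[OF _ w, of "{higman_relator i}"] by blast
  have o: "oact {higman_relator i} (bs i)" by (simp add: oact_def oaut_bs bs_relator)
  have "act (bs i) (?a k) p = act (bs i) (bpow (i + 1) m) (act (bs i) (?a n) p)"
    using act_eqv[OF e o, of p] p by simp
  then have "k = n" "m = 0" by (cases p; simp add: act_bs_apow act_bs_bpow)+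
  then have "eqv R (?a k @ w) (?a k)" using eqv_mono[OF e, of R] R by (simp add: bpow_simps)
  then have "eqv R (winv (?a k) @ ?a k @ w) (winv (?a k) @ ?a k)" by (intro eqv_append eqv.refl)
  moreover have "eqv R ((winv (?a k) @ ?a k) @ w) ([] @ w)" by (intro eqv_append eqv.refl eqv_inv_left)
  ultimately show ?thesis using eqv_inv_left[of R "?a k"] by simp (blast intro: eqv.trans eqv.sym)
qed

section \<open>The group generated by three consecutive generators\<close>

text \<open>The fourth generator is killed by an extra relator, so that all groups share one alphabet.\<close>
definition R3 :: "hword set" where
  "R3 = {higman_relator 0, higman_relator 1, [(3, False)]}"

lemma eqv_filter:
  assumes "[(3, False)] \<in> R" shows "eqv R w (filter (\<lambda>l. fst l \<noteq> 3) w)"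
proof (induction w)
  case (Cons l w)
  let ?w = "filter (\<lambda>l. fst l \<noteq> 3) w"
  have 1: "eqv R ([l] @ w) ([l] @ ?w)" by (rule eqv_append[OF eqv.refl Cons])
  show ?case
  proof (cases "fst l = 3")
    case True
    have f: "eqv R [(3, False)] []" using eqv.rel[OF assms, of "[]" "[]"] by simp
    then have "eqv R [l] []" using True eqv_winv[OF f] by (cases l; cases "snd l") (auto simp: inv_letter_def)
    from eqv.trans[OF 1 eqv_append[OF this eqv.refl]] show ?thesis using True by simp
  qed (use 1 in simp)
qed (simp add: eqv.refl)

definition affine_act :: "4 \<Rightarrow> real \<Rightarrow> real" where
  "affine_act i y = (if i = 0 then 2 * y else if i = 1 then y + 1 else y)"

lemma oaut_affine: "oaut (affine_act i)"
proof -
  consider "i = 0" | "i = 1" | "i \<noteq> 0" "i \<noteq> 1" by blast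
  then show ?thesis
  proof cases
    case 1 then show ?thesis using oaut_scaling[of 2] by (simp add: affine_act_def[abs_def])
  next
    case 2 then show ?thesis using oaut_translation[of 1] by (simp add: affine_act_def[abs_def])
  next
    case 3 then have "affine_act i = (\<lambda>y. y)" by (auto simp: affine_act_def)
    then show ?thesis by simp
  qed
qed

lemma oact_affine: "oact R3 affine_act"
proof -
  have "act affine_act (higman_relator i) y = y" if "i = 0 \<or> i = 1" for i y
    using that by (intro oact_relatorI oaut_affine) (auto simp: affine_act_def)
  then show ?thesis by (auto simp: oact_def R3_def oaut_affine letter_act_def affine_act_def)
qed

text \<open>The exponent sum n governs all three actions. A fixed point on the affine line forces n
  = 0, which makes both Baumslag-Solitar actions trivial: the freeness condition for amalgamating
  over b.\<close>

lemma affine_bs_powers: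
  "c \<in> wd {1} \<Longrightarrow> \<exists>n::int. (\<forall>y. act affine_act c y = y + n) \<and>
    (\<forall>r s. act (bs 0) c (Lex r s) = Lex (r + n) s) \<and>
    (\<forall>r s. act (bs 1) c (Lex r s) = Lex (2 powr n * r) (s + n))"
proof (induction c)
  case Nil show ?case by (intro exI[of _ 0]) simp
next
  case (Cons l c)
  then obtain n :: int where n: "\<And>y. act affine_act c y = y + real_of_int n"
    "\<And>r s. act (bs 0) c (Lex r s) = Lex (r + real_of_int n) s"
    "\<And>r s. act (bs 1) c (Lex r s) = Lex (2 powr real_of_int n * r) (s + real_of_int n)" by auto
  have l: "fst l = 1" using Cons(2) by simp
  have fwd: "affine_act 1 y = y + 1" "bs 0 1 p = Lex (lfst p + 1) (lsnd p)" "bs 1 1 p = Lex (2 * lfst p) (lsnd p + 1)"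
    for y p by (simp_all add: affine_act_def bs_def)
  have inv: "finv (affine_act 1) y = y - 1" for y
    by (rule finv_eqI[OF oaut_affine]) (simp add: fwd)
  show ?case
  proof (cases "snd l")
    case True
    then show ?thesis using l n
      by (intro exI[of _ "n - 1"]) (simp add: letter_act_def inv finv_bs powr_diff)
  next
    case False
    then show ?thesis using l n
      by (intro exI[of _ "n + 1"]) (simp add: letter_act_def fwd powr_add)
  qed
qed

lemma R3_order: "\<exists>lt. word_order R3 lt"
proof (rule separated_order[where 't = "(((real, (real, real) lex) lex, (real, real) lex) lex, real) lex"])
  fix w assume w: "\<not> eqv R3 w []"
  let ?RA = "{higman_relator 0, [(3, False)]}" and ?RB = "{higman_relator 1}"
  \<comment> \<open>The killed generator has to belong to a factor; it is put into the first, where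
    \<open>bs 0\<close> lets it act trivially.\<close>
  let ?JA = "{0, 1, 3} :: 4 set" and ?JB = "{1, 2} :: 4 set"
  have J: "?JA \<union> ?JB = UNIV" by (auto simp: UNIV4)
  have R: "?RA \<subseteq> wd ?JA" "?RB \<subseteq> wd ?JB" "R3 = ?RA \<union> ?RB" by (auto simp: higman_relator_def R3_def)
  have b3: "bs 0 3 = (\<lambda>p. p)" by (auto simp: bs_def)
  have \<theta>: "oact ?RA (bs 0)" "oact ?RB (bs 1)"
    by (auto simp: oact_def oaut_bs bs_relator letter_act_def b3)
  have C: "wd (?JA \<inter> ?JB) = wd {1}" by (rule arg_cong[of _ _ wd]) auto
  have fr: "act (bs 0) c x = x" "act (bs 1) c x = x" if "c \<in> wd (?JA \<inter> ?JB)" "act affine_act c y = y" for c x y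
    using that(2) affine_bs_powers[of c] that(1) unfolding C by (cases x; auto)+
  show "\<exists>\<rho> :: 4 \<Rightarrow> (((real, (real, real) lex) lex, (real, real) lex) lex, real) lex \<Rightarrow> _.
    oact R3 \<rho> \<and> (\<exists>p. act \<rho> w p \<noteq> p)"
  proof (rule amalgam_separated[OF J R oact_affine \<theta> _ _ _ _ w])
    fix w p assume w: "w \<in> wd ?JA" "act (bs 0) w p = p"
    let ?w = "filter (\<lambda>l. fst l \<noteq> 3) w"
    have "oact {[(3, False)]} (bs 0)" using \<theta>(1) by (simp add: oact_def)
    with eqv_filter[of "{[(3, False)]}" w] have "act (bs 0) ?w p = p" using act_eqv w(2) by fastforce
    moreover have "?w \<in> wd {0, 0 + 1}" using w(1) by (auto simp: wd_def)
    ultimately have "eqv R3 ?w []" by (intro bs_free[of 0]) (auto simp: R3_def)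
    moreover have "eqv R3 w ?w" by (rule eqv_filter) (simp add: R3_def)
    ultimately show "eqv R3 w []" by (blast intro: eqv.trans)
  next
    fix w p assume "w \<in> wd ?JB" "act (bs 1) w p = p"
    then show "eqv R3 w []" by (intro bs_free[of 1]) (auto simp: R3_def)
  qed (use fr in auto)
qed

text \<open>The fibres of the next amalgam need a linearly ordered type, so the order found for A
  becomes a class instance.\<close>

typedef g3 = "range (\<lambda>w. {v. eqv R3 w v})" by auto

definition cls3 :: "hword \<Rightarrow> g3" where "cls3 w = Abs_g3 {v. eqv R3 w v}"

lemma eqv_classes: "{x. eqv R u x} = {x. eqv R v x} \<longleftrightarrow> eqv R u v"
  using eqv.refl eqv.sym eqv.trans by blast

lemma cls3_eq: "cls3 u = cls3 v \<longleftrightarrow> eqv R3 u v"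
  unfolding cls3_def by (subst Abs_g3_inject) (auto simp: eqv_classes)

lemma surj_cls3: "surj cls3"
proof (rule surjI)
  fix x
  have "\<exists>w. {v. eqv R3 w v} = Rep_g3 x" using Rep_g3[of x] by auto
  from someI_ex[OF this] show "cls3 (SOME w. {v. eqv R3 w v} = Rep_g3 x) = x"
    by (simp add: cls3_def Rep_g3_inverse)
qed

instantiation g3 :: linorder
begin
definition less_g3 :: "g3 \<Rightarrow> g3 \<Rightarrow> bool" where
  "less_g3 x y \<longleftrightarrow> (\<exists>u v. x = cls3 u \<and> y = cls3 v \<and> (SOME lt. word_order R3 lt) u v)"
definition less_eq_g3 :: "g3 \<Rightarrow> g3 \<Rightarrow> bool" where "less_eq_g3 x y \<longleftrightarrow> x = y \<or> x < y"
instance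
proof -
  note o = quotient_order[OF someI_ex[OF R3_order] cls3_eq surj_cls3 less_g3_def]
  have irrefl: "\<not> x < x" for x :: g3 by (rule o(2))
  have trans: "x < y \<Longrightarrow> y < z \<Longrightarrow> x < z" for x y z :: g3 by (rule o(3))
  have total: "x \<noteq> y \<Longrightarrow> x < y \<or> y < x" for x y :: g3 using o(4) by blast
  show "OFCLASS(g3, linorder_class)"
    by standard (auto simp: less_eq_g3_def irrefl dest: trans total)
qed
end

lemma g3_action:
  obtains \<theta> :: "4 \<Rightarrow> g3 \<Rightarrow> g3" where "oact R3 \<theta>" "\<And>w v. act \<theta> w (cls3 v) = cls3 (w @ v)"
  by (rule quotient_action[OF someI_ex[OF R3_order] cls3_eq surj_cls3
        quotient_order(1)[OF someI_ex[OF R3_order] cls3_eq surj_cls3 less_g3_def]]) blast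

section \<open>An ordered set on which a_0 and a_2 act freely\<close>

text \<open>Pushing a through the word s in the first coordinate leaves a to the power
  \<open>wt True s\<close>, by which the second coordinate is multiplied; there the types
  \<open>True\<close> and \<open>False\<close> stand for powers of a and c. The first coordinate
  alone would not do, since a and c both fix its neutral element.\<close>

definition aff2 :: "4 \<Rightarrow> (fw, fw) lex \<Rightarrow> (fw, fw) lex" where
  "aff2 i p = (if i = 0 \<or> i = 2
     then Lex (scale (i = 0) 1 (lfst p)) (gen (i = 0) (wt (i = 0) (lfst p)) + lsnd p)
     else Lex (gen (i = 1) 1 + lfst p) (lsnd p))"

lemma oaut_aff2: "oaut (aff2 i)"
proof (cases "i = 0 \<or> i = 2")
  case True
  show ?thesis by (rule oaut_lexI[OF oaut_scale[of "i = 0" 1] oaut_add]) (use True in \<open>auto simp: aff2_def\<close>)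
next
  case False
  show ?thesis by (rule oaut_lexI[OF oaut_add[of "gen (i = 1) 1"] oaut_id(2)]) (use False in \<open>auto simp: aff2_def\<close>)
qed

lemma oact_aff2: "oact (range higman_relator) aff2"
proof -
  have half: "2 * 2 powr (- 1) = (1 :: real)" by (simp add: powr_minus)
  have a: "gen k 1 + (gen k 1 + s) = gen k 2 + s" for k s by (simp add: gen_add flip: add.assoc)
  \<comment> \<open>For \<open>k = True\<close>, \<open>1\<close> is a b = b^2 a and
    \<open>2\<close> is d a = a^2 d in the first coordinate, and \<open>3\<close> is the latter in
    the second coordinate; \<open>k = False\<close> gives the relations of c with d and b.\<close>
  have 1: "scale k 1 (gen k 1 + s) = gen k 1 + (gen k 1 + scale k 1 s)" for k s
    by (simp add: scale_add scale_gen wt_gen1 a)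
  have 2: "scale k 1 (scale k 1 (gen (\<not> k) 1 + s)) = gen (\<not> k) 1 + scale k 1 s" for k s
    using half by (simp add: scale_scale scale_add scale_gen wt_gen1)
  have 3: "gen k (2 powr (- 1) * wt k s) + (gen k (2 powr (- 1) * wt k s) + x) = gen k (wt k s) + x" for k s x
    by (simp add: gen_add powr_minus flip: add.assoc)
  note r = 1[of True] 1[of False] 2[of True] 2[of False] 3[of True] 3[of False]
    wt_gen(1)[of True] wt_gen(1)[of False] wt_gen(2)[of True] wt_gen(2)[of False]
  have "aff2 i (aff2 (i + 1) p) = aff2 (i + 1) (aff2 (i + 1) (aff2 i p))" for i p
    using exhaust4[of i] by (elim disjE) (use r in \<open>simp_all add: aff2_def wt_scale\<close>)
  then have "act aff2 (higman_relator i) p = p" for i p by (intro oact_relatorI oaut_aff2)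
  then show ?thesis by (auto simp: oact_def oaut_aff2)
qed

section \<open>Reduced words in a_0 and a_2 move every point\<close>

lemma free_reduction:
  "\<exists>d. eqv {} c d \<and> (c \<in> wd J \<longrightarrow> d \<in> wd J) \<and> successively (\<lambda>x y. y \<noteq> inv_letter x) d"
proof (induction c)
  case Nil show ?case by (intro exI[of _ "[]"]) (simp add: eqv.refl)
next
  case (Cons l c)
  then obtain d where d: "eqv {} c d" "c \<in> wd J \<longrightarrow> d \<in> wd J" "successively (\<lambda>x y. y \<noteq> inv_letter x) d" by blast
  have 1: "eqv {} ([l] @ c) ([l] @ d)" by (rule eqv_append[OF eqv.refl d(1)])
  show ?case
  proof (cases "d \<noteq> [] \<and> hd d = inv_letter l")
    case True
    then obtain d' where d': "d = inv_letter l # d'" by (cases d) auto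
    have "eqv {} ([l] @ c) d'" using eqv.trans[OF 1] eqv.cancel[of "{}" "[]" l d'] by (simp add: d')
    then show ?thesis using d by (intro exI[of _ d']) (auto simp: d' successively_Cons)
  next
    case False
    then show ?thesis using d 1 by (intro exI[of _ "l # d"]) (auto simp: successively_Cons)
  qed
qed

lemma letter_act_aff2:
  assumes "fst l = 0 \<or> fst l = 2"
  shows "\<exists>c. c \<noteq> 0 \<and> (c > 0 \<longleftrightarrow> \<not> snd l) \<and> lsnd (letter_act aff2 l p) = gen (fst l = 0) c + lsnd p"
proof (cases "snd l")
  case False
  then show ?thesis using assms wt_pos[of "fst l = 0" "lfst p"]
    by (intro exI[of _ "wt (fst l = 0) (lfst p)"]) (auto simp: letter_act_def aff2_def)
next
  case True
  let ?k = "fst l = 0"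
  let ?s = "scale ?k (- 1) (lfst p)"
  have "finv (aff2 (fst l)) p = Lex ?s (gen ?k (- wt ?k ?s) + lsnd p)"
    by (rule finv_eqI[OF oaut_aff2])
      (use assms in \<open>auto simp: aff2_def scale_scale scale_0 gen_add gen_0 lex.expand simp flip: add.assoc\<close>)
  then show ?thesis using True wt_pos[of ?k ?s]
    by (intro exI[of _ "- wt ?k ?s"]) (auto simp: letter_act_def)
qed

text \<open>Each letter multiplies the second coordinate by a syllable whose type and sign are those
  of the letter, whatever its size. In a reduced word, neighbours on the same generator have equal
  signs, so their exponents add without cancelling and the leading syllable survives.\<close>

lemma aff2_reduced_word:
  assumes "d \<in> wd {0, 2}" "d \<noteq> []" "successively (\<lambda>x y. y \<noteq> inv_letter x) d"
  shows "\<exists>q. Rep_fw q \<noteq> [] \<and> fst (hd (Rep_fw q)) = (fst (hd d) = 0) \<and>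
    (snd (hd (Rep_fw q)) > 0 \<longleftrightarrow> \<not> snd (hd d)) \<and> lsnd (act aff2 d p) = q + lsnd p"
  using assms
proof (induction d)
  case (Cons l d)
  have l: "fst l = 0 \<or> fst l = 2" using Cons(2) by simp
  from letter_act_aff2[OF l, of "act aff2 d p"] obtain c where c: "c \<noteq> 0" "c > 0 \<longleftrightarrow> \<not> snd l"
    "lsnd (act aff2 (l # d) p) = gen (fst l = 0) c + lsnd (act aff2 d p)" by auto
  have gen: "Rep_fw (gen k c) = [(k, c)]" for k using c(1) by (simp add: gen.rep_eq)
  show ?case
  proof (cases "d = []")
    case True
    then show ?thesis using c gen by (intro exI[of _ "gen (fst l = 0) c"]) simp
  next
    case False
    then obtain q where q: "Rep_fw q \<noteq> []" "fst (hd (Rep_fw q)) = (fst (hd d) = 0)"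
      "snd (hd (Rep_fw q)) > 0 \<longleftrightarrow> \<not> snd (hd d)" "lsnd (act aff2 d p) = q + lsnd p"
      using Cons by (auto simp: successively_Cons)
    obtain b r t where b: "Rep_fw q = (b, r) # t" using q(1) by (cases "Rep_fw q") auto
    have r: "r \<noteq> 0" using Rep_fw[of q] b by auto
    have hd: "fst (hd d) = 0 \<or> fst (hd d) = 2" using Cons(2) False by (cases d) auto
    have ne: "hd d \<noteq> inv_letter l" using Cons(4) False by (auto simp: successively_Cons)
    have same: "snd l = snd (hd d)" if "b = (fst l = 0)"
      using that ne hd l q(2) b by (auto simp: inv_letter_def prod_eq_iff)
    have "Rep_fw (gen (fst l = 0) c + q) = sh (fst l = 0, c) ((b, r) # t)"
      by (simp add: plus_fw.rep_eq gen b)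
    moreover have "c + r \<noteq> 0 \<and> (c + r > 0 \<longleftrightarrow> \<not> snd l)" if "b = (fst l = 0)"
      using c(1,2) r q(3) b same[OF that] by auto
    ultimately have "Rep_fw (gen (fst l = 0) c + q) \<noteq> [] \<and> fst (hd (Rep_fw (gen (fst l = 0) c + q))) = (fst l = 0) \<and>
      (snd (hd (Rep_fw (gen (fst l = 0) c + q))) > 0 \<longleftrightarrow> \<not> snd l)"
      using c by (auto simp: sh_def)
    then show ?thesis using c(3) q(4) by (intro exI[of _ "gen (fst l = 0) c + q"]) (simp add: add.assoc)
  qed
qed simp

text \<open>A word with a fixed point is trivial already in the free group, hence acts trivially
  under every action. The arbitrary \<open>\<theta>\<close> lets this serve both factors.\<close>

lemma aff2_free:
  assumes c: "c \<in> wd {0, 2}" "act aff2 c p = p" and \<theta>: "oact R \<theta>" shows "act \<theta> c x = x"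
proof -
  obtain d where d: "eqv {} c d" "d \<in> wd {0, 2}" "successively (\<lambda>x y. y \<noteq> inv_letter x) d"
    using free_reduction c(1) by blast
  have o: "oact {} aff2" "oact {} \<theta>" using oact_aff2 \<theta> by (auto simp: oact_def)
  have "d = []"
  proof (rule ccontr)
    assume "d \<noteq> []"
    from aff2_reduced_word[OF d(2) this d(3), of p] obtain q where
      q: "Rep_fw q \<noteq> []" "lsnd (act aff2 d p) = q + lsnd p" by blast
    have "q + lsnd p = lsnd p" using q(2) act_eqv[OF d(1) o(1), of p] c(2) by simp
    then have "q = 0" by (metis add.left_neutral add_right_cancel)
    then show False using q(1) by (simp add: zero_fw.rep_eq)
  qed
  then show ?thesis using act_eqv[OF d(1) o(2), of x] by simp
qed

section \<open>Higman's group\<close>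

definition RH :: "hword set" where "RH = range higman_relator"

text \<open>Deleting the letter 3 describes, on words, the homomorphism from A to Higman's group:
  the killing relator becomes empty and the other two stay as they are.\<close>

lemma eqv_R3_RH: "eqv R3 u v \<Longrightarrow> eqv RH (filter (\<lambda>l. fst l \<noteq> 3) u) (filter (\<lambda>l. fst l \<noteq> 3) v)"
proof (induction rule: eqv.induct)
  case (cancel u l v)
  then show ?case using eqv.cancel[of RH "filter (\<lambda>l. fst l \<noteq> 3) u" l "filter (\<lambda>l. fst l \<noteq> 3) v"]
    by (cases "fst l = 3") (auto simp: inv_letter_def eqv.refl)
next
  case (rel r u v)
  have "filter (\<lambda>l. fst l \<noteq> 3) (higman_relator i) = higman_relator i" if "i = 0 \<or> i = 1" for i
    using that by (auto simp: higman_relator_def)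
  then show ?case using rel eqv.rel[of "higman_relator 0" RH] eqv.rel[of "higman_relator 1" RH]
    by (auto simp: R3_def RH_def eqv.refl)
qed (auto intro: eqv.intros)

definition shift2 :: "hword \<Rightarrow> hword" where "shift2 = map (\<lambda>l. (fst l + 2, snd l))"

lemma shift2_simps [simp]: "shift2 [] = []" "shift2 (l # w) = (fst l + 2, snd l) # shift2 w"
  "shift2 (u @ v) = shift2 u @ shift2 v"
  by (auto simp: shift2_def)

lemma shift2_shift2: "shift2 (shift2 w) = w"
  by (induction w) (auto simp: add.assoc)

lemma shift2_relator: "shift2 (higman_relator i) = higman_relator (i + 2)"
  by (simp add: higman_relator_def add_ac)

text \<open>Rotation by two permutes the relators. This symmetry exchanges A and B, so the ordered
  group built for A serves both factors.\<close>

lemma eqv_shift2: "eqv RH u v \<Longrightarrow> eqv RH (shift2 u) (shift2 v)"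
proof (induction rule: eqv.induct)
  case (cancel u l v)
  then show ?case using eqv.cancel[of RH "shift2 u" "(fst l + 2, snd l)" "shift2 v"] by (simp add: inv_letter_def)
next
  case (rel r u v)
  then show ?case using eqv.rel[of _ RH "shift2 u" "shift2 v"] by (auto simp: RH_def shift2_relator)
qed (auto intro: eqv.intros)

lemma four_eq_0: "(4 :: 4) = 0" "(5 :: 4) = 1"
  by simp_all

lemma act_shift2: "act (\<lambda>i. \<theta> (i + 2)) w = act \<theta> (shift2 w)"
  by (induction w) (auto simp: letter_act_def)

lemma higman_order: "\<exists>lt. word_order RH lt"
proof (rule separated_order[where 't = "((((fw, fw) lex, g3) lex, g3) lex, real) lex"])
  fix w assume w: "\<not> eqv RH w []"
  let ?RA = "{higman_relator 0, higman_relator 1}" and ?RB = "{higman_relator 2, higman_relator 3}"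
  let ?JA = "{0, 1, 2} :: 4 set" and ?JB = "{2, 3, 0} :: 4 set"
  have J: "?JA \<union> ?JB = UNIV" by (auto simp: UNIV4)
  have R: "?RA \<subseteq> wd ?JA" "?RB \<subseteq> wd ?JB" by (auto simp: higman_relator_def four_eq_0)
  have RH: "RH = ?RA \<union> ?RB" by (auto simp: RH_def UNIV4)
  obtain \<theta> :: "4 \<Rightarrow> g3 \<Rightarrow> g3" where \<theta>: "oact R3 \<theta>" "\<And>w v. act \<theta> w (cls3 v) = cls3 (w @ v)"
    by (rule g3_action) blast
  let ?\<theta>' = "\<lambda>i. \<theta> (i + 2)"
  have \<theta>A: "oact ?RA \<theta>" using \<theta>(1) by (auto simp: oact_def R3_def)
  have \<theta>B: "oact ?RB ?\<theta>'" using \<theta>(1) by (auto simp: oact_def R3_def act_shift2 shift2_relator four_eq_0)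
  have C: "wd (?JA \<inter> ?JB) = wd {0, 2}" by (rule arg_cong[of _ _ wd]) auto
  \<comment> \<open>In a regular action a fixed point means triviality in A, which the deletion
    homomorphism carries over to Higman's group.\<close>
  have free: "eqv RH w []" if w: "w \<in> wd ?JA" "act \<theta> w x = x" for w x
  proof -
    obtain v where x: "x = cls3 v" using surj_cls3 by (meson surjD)
    have "eqv R3 ((w @ v) @ winv v) (v @ winv v)"
      using w(2) by (intro eqv_append eqv.refl) (simp add: x \<theta>(2) cls3_eq)
    moreover have "eqv R3 (w @ v @ winv v) (w @ [])" by (rule eqv_append[OF eqv.refl eqv_inv_right])
    ultimately have "eqv R3 w []" using eqv_inv_right[of R3 v] by simp (blast intro: eqv.trans eqv.sym)
    from eqv_R3_RH[OF this] moreover have "filter (\<lambda>l. fst l \<noteq> 3) w = w"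
      using w(1) by (auto simp: wd_def filter_id_conv)
    ultimately show ?thesis by simp
  qed
  show "\<exists>\<rho> :: 4 \<Rightarrow> ((((fw, fw) lex, g3) lex, g3) lex, real) lex \<Rightarrow> _. oact RH \<rho> \<and> (\<exists>p. act \<rho> w p \<noteq> p)"
  proof (rule amalgam_separated[OF J R RH oact_aff2[folded RH_def] \<theta>A \<theta>B _ _ _ _ w])
    fix w x assume wx: "w \<in> wd ?JB" "act ?\<theta>' w x = x"
    have "shift2 w \<in> wd ?JA" using wx(1) by (auto simp: wd_def shift2_def)
    then have "eqv RH (shift2 w) []" using wx(2) by (intro free) (simp_all add: act_shift2)
    from eqv_shift2[OF this] show "eqv RH w []" by (simp add: shift2_shift2)
  qed (use aff2_free[OF _ _ \<theta>A] aff2_free[OF _ _ \<theta>B] free C in auto)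
qed

section \<open>Realization by homeomorphisms of the line\<close>

text \<open>Unit steps beyond the points already placed will make the image unbounded, and midpoints
  will make it dense.\<close>

definition mid :: "real set \<Rightarrow> real set \<Rightarrow> real" where
  "mid L U = (if L = {} then if U = {} then 0 else Min U - 1
     else if U = {} then Max L + 1 else (Max L + Min U) / 2)"

lemma mid_between:
  assumes fin: "finite L" "finite U" and lt: "\<And>l u. l \<in> L \<Longrightarrow> u \<in> U \<Longrightarrow> l < u"
  shows "l \<in> L \<Longrightarrow> l < mid L U" "u \<in> U \<Longrightarrow> mid L U < u"
proof -
  have *: "Max L < Min U" if "L \<noteq> {}" "U \<noteq> {}" using that fin lt by simp
  show "l < mid L U" if l: "l \<in> L"
  proof -
    have "l \<le> Max L" "L \<noteq> {}" using l fin by auto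
    then show ?thesis using * by (cases "U = {}") (simp_all add: mid_def)
  qed
  show "mid L U < u" if u: "u \<in> U"
  proof -
    have "Min U \<le> u" "U \<noteq> {}" using u fin by auto
    then show ?thesis using * by (cases "L = {}") (simp_all add: mid_def)
  qed
qed

text \<open>Points are placed in the order of their index \<open>to_nat\<close>, each in the gap
  that the earlier ones leave for it.\<close>

function emb :: "'x::{countable, linorder} \<Rightarrow> real" where
  "emb x = mid (emb ` {y. to_nat y < to_nat x \<and> y < x}) (emb ` {y. to_nat y < to_nat x \<and> x < y})"
  by auto
termination by (relation "Wellfounded.measure to_nat") auto

declare emb.simps [simp del]

lemma finite_to_nat_less: "finite {y :: 'x::countable. to_nat y < n}" "finite {y :: 'x. to_nat y < n \<and> P y}"
proof -
  have "to_nat ` {y :: 'x. to_nat y < n} \<subseteq> {..<n}" by auto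
  then show *: "finite {y :: 'x. to_nat y < n}"
    by (rule inj_on_finite[rotated]) (auto intro: inj_on_subset)
  show "finite {y :: 'x. to_nat y < n \<and> P y}" by (rule finite_subset[OF _ *]) auto
qed

lemma emb_less:
  fixes x y :: "'x::{countable, linorder}"
  shows "x < y \<Longrightarrow> emb x < emb y"
proof -
  have "\<forall>x y :: 'x. to_nat x < n \<longrightarrow> to_nat y < n \<longrightarrow> x < y \<longrightarrow> emb x < emb y" for n
  proof (induction n)
    case (Suc n)
    have "emb y < emb x \<longleftrightarrow> y < x" "emb x < emb y \<longleftrightarrow> x < y"
      if x: "to_nat x = n" and y: "to_nat y < n" for x y :: 'x
    proof -
      let ?L = "{y. to_nat y < to_nat x \<and> y < x}" and ?U = "{y. to_nat y < to_nat x \<and> x < y}"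
      have lu: "l < u" if "l \<in> emb ` ?L" "u \<in> emb ` ?U" for l u
        using that Suc x by (auto simp: less_trans)
      have fin: "finite (emb ` ?L)" "finite (emb ` ?U)" by (auto simp: finite_to_nat_less)
      have "y < x \<Longrightarrow> emb y < emb x" unfolding emb.simps[of x]
        by (rule mid_between(1)[OF fin lu]) (use x y in auto)
      moreover have "x < y \<Longrightarrow> emb x < emb y" unfolding emb.simps[of x]
        by (rule mid_between(2)[OF fin lu]) (use x y in auto)
      moreover have "x \<noteq> y" using x y by auto
      ultimately show "emb y < emb x \<longleftrightarrow> y < x" "emb x < emb y \<longleftrightarrow> x < y" by (auto simp: neq_iff)
    qed
    then show ?case using Suc by (auto simp: less_Suc_eq)
  qed simp
  then show "x < y \<Longrightarrow> emb x < emb y" by (meson less_Suc_eq max.strict_coboundedI1 max.strict_coboundedI2 lessI)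
qed

lemma emb_mono: "emb x < emb y \<longleftrightarrow> x < y" "emb x \<le> emb y \<longleftrightarrow> x \<le> y" "emb x = emb y \<longleftrightarrow> x = y"
  using emb_less[of x y] emb_less[of y x] by (cases x y rule: linorder_cases, auto)+

section \<open>The image of a dense unbounded order is unbounded and dense in the line\<close>

instance lex :: (countable, countable) countable
  by (rule countable_classI[of "\<lambda>p. to_nat (lfst p, lsnd p)"]) (auto simp: lex.expand)

instance lex :: (linorder, unbounded_dense_linorder) unbounded_dense_linorder
proof
  fix p q :: "('a, 'b) lex"
  obtain x r where p: "p = Lex x r" by (cases p)
  show "\<exists>q. p < q" "\<exists>q. q < p"
    using gt_ex[of r] lt_ex[of r] by (auto simp: p) (metis less_Lex)+
  assume l: "p < q"
  obtain y s where q: "q = Lex y s" by (cases q)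
  show "\<exists>z. p < z \<and> z < q"
  proof (cases "x = y")
    case True
    then obtain t where "r < t" "t < s" using dense[of r s] l by (auto simp: p q)
    then show ?thesis by (intro exI[of _ "Lex x t"]) (simp add: p q True)
  next
    case False
    obtain t where "r < t" using gt_ex by blast
    then show ?thesis using l False by (intro exI[of _ "Lex x t"]) (auto simp: p q)
  qed
qed

lemma least_index:
  assumes "P (z :: 'x::countable)" obtains w where "P w" "\<And>y. to_nat y < to_nat w \<Longrightarrow> \<not> P y"
proof -
  have "\<exists>w. P w \<and> (\<forall>y. P y \<longrightarrow> to_nat w \<le> to_nat y)" using assms by (rule ex_has_least_nat)
  then show ?thesis using that by (meson not_le)
qed

text \<open>Take the first point in the enumeration above all points with index up to that of x. No
  point placed earlier lies above it, so it lands one unit beyond the largest value so far, which is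
  at least \<open>emb x\<close>.\<close>

lemma emb_step_up:
  fixes x :: "'x::{countable, unbounded_dense_linorder}"
  shows "\<exists>z :: 'x. emb z \<ge> emb x + 1"
proof -
  let ?S = "{y :: 'x. to_nat y < Suc (to_nat x)}"
  have S: "finite ?S" "x \<in> ?S" by (auto simp: finite_to_nat_less)
  obtain z where "Max ?S < z" using gt_ex by blast
  then obtain w where w: "Max ?S < w" "\<And>y. to_nat y < to_nat w \<Longrightarrow> \<not> Max ?S < y"
    by (rule least_index[where P = "\<lambda>y. Max ?S < y"]) blast
  have "to_nat x < to_nat w"
  proof (rule ccontr)
    assume "\<not> to_nat x < to_nat w"
    then have "w \<le> Max ?S" using S by (intro Max_ge) auto
    then show False using w(1) by simp
  qed
  moreover have "x < w" using w(1) S Max_ge[of ?S x] by (metis le_less_trans)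
  moreover have U: "{y. to_nat y < to_nat w \<and> w < y} = {}" using w less_trans by blast
  let ?L = "emb ` {y. to_nat y < to_nat w \<and> y < w}"
  have "emb w = (if ?L = {} then 0 else Max ?L + 1)" 
    by (subst emb.simps) (simp only: U mid_def image_empty simp_thms if_True)
  moreover have "finite ?L" by (simp add: finite_to_nat_less)
  ultimately have "emb x \<in> ?L" "emb w = Max ?L + 1" by auto
  then have "emb w \<ge> emb x + 1" using Max_ge[OF \<open>finite ?L\<close>, of "emb x"] by simp
  then show ?thesis by blast
qed

lemma emb_step_down:
  fixes x :: "'x::{countable, unbounded_dense_linorder}"
  shows "\<exists>z :: 'x. emb z \<le> emb x - 1"
proof -
  let ?S = "{y :: 'x. to_nat y < Suc (to_nat x)}"
  have S: "finite ?S" "x \<in> ?S" by (auto simp: finite_to_nat_less)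
  obtain z where "z < Min ?S" using lt_ex by blast
  then obtain w where w: "w < Min ?S" "\<And>y. to_nat y < to_nat w \<Longrightarrow> \<not> y < Min ?S"
    by (rule least_index[where P = "\<lambda>y. y < Min ?S"]) blast
  have "to_nat x < to_nat w"
  proof (rule ccontr)
    assume "\<not> to_nat x < to_nat w"
    then have "Min ?S \<le> w" using S by (intro Min_le) auto
    then show False using w(1) by simp
  qed
  moreover have "w < x" using w(1) S Min_le[of ?S x] by (metis less_le_trans)
  moreover have L: "{y. to_nat y < to_nat w \<and> y < w} = {}" using w less_trans by blast
  let ?U = "emb ` {y. to_nat y < to_nat w \<and> w < y}"
  have "emb w = (if ?U = {} then 0 else Min ?U - 1)" 
    by (subst emb.simps) (simp only: L mid_def image_empty simp_thms if_True)
  moreover have "finite ?U" by (simp add: finite_to_nat_less)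
  ultimately have "emb x \<in> ?U" "emb w = Min ?U - 1" by auto
  then have "emb w \<le> emb x - 1" using Min_le[OF \<open>finite ?U\<close>, of "emb x"] by simp
  then show ?thesis by blast
qed

lemma emb_unbounded:
  "\<exists>x :: 'x::{countable, unbounded_dense_linorder}. r < emb x" "\<exists>x :: 'x. emb x < r"
proof -
  fix x0 :: 'x
  have "\<exists>x :: 'x. emb x \<ge> emb x0 + real n" for n
  proof (induction n)
    case (Suc n)
    then obtain x :: 'x where "emb x \<ge> emb x0 + real n" by blast
    then show ?case using emb_step_up[of x] by (smt (verit) of_nat_Suc)
  qed auto
  moreover obtain n where "real n > r - emb x0" using reals_Archimedean2 by blast
  ultimately show "\<exists>x :: 'x. r < emb x" by (smt (verit))
  have "\<exists>x :: 'x. emb x \<le> emb x0 - real n" for n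
  proof (induction n)
    case (Suc n)
    then obtain x :: 'x where "emb x \<le> emb x0 - real n" by blast
    then show ?case using emb_step_down[of x] by (smt (verit) of_nat_Suc)
  qed auto
  moreover obtain n where "real n > emb x0 - r" using reals_Archimedean2 by blast
  ultimately show "\<exists>x :: 'x. emb x < r" by (smt (verit))
qed

text \<open>In a gap of the image, the first point placed between two points close to its ends would land
  inside the gap.\<close>
lemma emb_dense:
  assumes "a < b" shows "\<exists>x :: 'x::{countable, unbounded_dense_linorder}. a < emb x \<and> emb x < b"
proof (rule ccontr)
  assume no: "\<not> ?thesis"
  let ?A = "{emb x | x :: 'x. emb x \<le> a}" and ?B = "{emb x | x :: 'x. b \<le> emb x}"
  define a' where "a' = Sup ?A"
  define b' where "b' = Inf ?B"
  have ne: "?A \<noteq> {}" "?B \<noteq> {}" using emb_unbounded(2)[of a] emb_unbounded(1)[of b] by (auto intro: less_imp_le)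
  have bd: "bdd_above ?A" "bdd_below ?B" by (auto intro: bdd_aboveI bdd_belowI)
  have le: "a' \<le> a" "b \<le> b'" unfolding a'_def b'_def using ne by (auto intro!: cSup_least cInf_greatest)
  have a': "emb x \<le> a'" if "emb x \<le> a" for x :: 'x
    unfolding a'_def using that bd by (intro cSup_upper) auto
  have b': "b' \<le> emb x" if "b \<le> emb x" for x :: 'x
    unfolding b'_def using that bd by (intro cInf_lower) auto
  let ?d = "b' - a'"
  have d: "?d > 0" using le assms by simp
  have "\<exists>t\<in>?A. a' - ?d < t" using d ne bd less_cSup_iff[of ?A "a' - ?d"] unfolding a'_def[symmetric] by auto
  then obtain x1 :: 'x where x1: "emb x1 \<le> a" "a' - ?d < emb x1" by auto
  have "\<exists>t\<in>?B. t < b' + ?d" using d ne bd cInf_less_iff[of ?B "b' + ?d"] unfolding b'_def[symmetric] by auto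
  then obtain x2 :: 'x where x2: "b \<le> emb x2" "emb x2 < b' + ?d" by auto
  define N where "N = Suc (max (to_nat x1) (to_nat x2))"
  let ?P = "{y :: 'x. to_nat y < N \<and> emb y \<le> a}" and ?Q = "{y :: 'x. to_nat y < N \<and> b \<le> emb y}"
  have fin: "finite ?P" "finite ?Q" by (auto simp: finite_to_nat_less)
  have in12: "x1 \<in> ?P" "x2 \<in> ?Q" using x1 x2 by (auto simp: N_def)
  define p where "p = Max ?P"
  define q where "q = Min ?Q"
  have pq: "p \<in> ?P" "q \<in> ?Q" unfolding p_def q_def using Max_in[OF fin(1)] Min_in[OF fin(2)] in12 by blast+
  have ple: "y \<le> p" if "y \<in> ?P" for y unfolding p_def by (rule Max_ge[OF fin(1) that])
  have qle: "q \<le> y" if "y \<in> ?Q" for y unfolding q_def by (rule Min_le[OF fin(2) that])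
  have "emb p < emb q" using pq assms by auto
  then have "p < q" by (simp add: emb_mono)
  then obtain z where "p < z \<and> z < q" using dense by blast
  then obtain w where w: "p < w \<and> w < q" "\<And>y. to_nat y < to_nat w \<Longrightarrow> \<not> (p < y \<and> y < q)"
    by (rule least_index[where P = "\<lambda>y. p < y \<and> y < q"]) blast
  \<comment> \<open>Every point of index below \<open>N\<close> lies on one side of the gap, hence
    not between \<open>p\<close> and \<open>q\<close>. So \<open>p\<close> and \<open>q\<close> are
    already placed when \<open>w\<close> is, and are its neighbours.\<close>
  have N: "N \<le> to_nat w"
  proof (rule ccontr)
    assume "\<not> N \<le> to_nat w"
    moreover have "emb w \<le> a \<or> b \<le> emb w" using no by (meson not_le)
    ultimately have "w \<le> p \<or> q \<le> w" using ple qle by auto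
    then show False using w(1) by auto
  qed
  let ?L = "emb ` {y. to_nat y < to_nat w \<and> y < w}" and ?U = "emb ` {y. to_nat y < to_nat w \<and> w < y}"
  have "Max ?L = emb p"
  proof (rule Max_eqI)
    fix t assume "t \<in> ?L"
    then obtain y where y: "t = emb y" "to_nat y < to_nat w" "y < w" by auto
    then have "y \<le> p" using w by (meson less_trans not_le)
    then show "t \<le> emb p" by (simp add: y emb_mono)
  qed (use pq N w in \<open>auto simp: finite_to_nat_less\<close>)
  moreover have "Min ?U = emb q"
  proof (rule Min_eqI)
    fix t assume "t \<in> ?U"
    then obtain y where y: "t = emb y" "to_nat y < to_nat w" "w < y" by auto
    then have "q \<le> y" using w by (meson less_trans not_le)
    then show "emb q \<le> t" by (simp add: y emb_mono)
  qed (use pq N w in \<open>auto simp: finite_to_nat_less\<close>)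
  moreover have "emb p \<in> ?L" "emb q \<in> ?U" using pq N w(1) by auto
  then have "?L \<noteq> {}" "?U \<noteq> {}" by blast+
  ultimately have emb: "emb w = (emb p + emb q) / 2" by (subst emb.simps) (simp only: mid_def if_False)
  have "emb x1 \<le> emb p" "emb q \<le> emb x2" using ple qle in12 by (auto simp: emb_mono)
  moreover have "emb p \<le> a'" "b' \<le> emb q" using a' b' pq by auto
  ultimately have "a' < emb w" "emb w < b'" using x1 x2 unfolding emb by auto
  moreover have "emb w \<le> a \<or> b \<le> emb w" using no by (meson not_le)
  ultimately show False using a' b' by fastforce
qed

section \<open>Extending order automorphisms to homeomorphisms of the line\<close>

definition line_ext :: "('x::{countable, linorder} \<Rightarrow> 'x) \<Rightarrow> real \<Rightarrow> real" where
  "line_ext f r = Sup ((\<lambda>y. emb (f y)) ` {y. emb y \<le> r})"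

lemma ext_mono:
  fixes f :: "'x::{countable, unbounded_dense_linorder} \<Rightarrow> 'x"
  assumes "oaut f" shows "mono (line_ext f)"
proof (rule monoI)
  fix r s :: real assume "r \<le> s"
  obtain y0 :: 'x where y0: "s < emb y0" using emb_unbounded by blast
  obtain y1 :: 'x where y1: "emb y1 < r" using emb_unbounded by blast
  show "line_ext f r \<le> line_ext f s" unfolding line_ext_def
  proof (rule cSup_subset_mono)
    show "bdd_above ((\<lambda>y. emb (f y)) ` {y. emb y \<le> s})"
    proof (rule bdd_aboveI[where M = "emb (f y0)"])
      fix t assume "t \<in> (\<lambda>y. emb (f y)) ` {y. emb y \<le> s}"
      then obtain y where y: "t = emb (f y)" "emb y \<le> s" by auto
      then have "y < y0" using y0 by (simp flip: emb_mono(1))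
      then show "t \<le> emb (f y0)" using assms y by (simp add: emb_mono less_imp_le)
    qed
  qed (use y1 \<open>r \<le> s\<close> in \<open>auto intro: less_imp_le\<close>)
qed

lemma ext_emb: assumes "oaut f" shows "line_ext f (emb x) = emb (f x)"
  unfolding line_ext_def
proof (rule cSup_eq_maximum)
  fix t assume "t \<in> (\<lambda>y. emb (f y)) ` {y. emb y \<le> emb x}"
  then obtain y where y: "t = emb (f y)" "y \<le> x" by (auto simp: emb_mono)
  then show "t \<le> emb (f x)" using assms by (auto simp: emb_mono le_less)
qed auto

text \<open>By density and surjectivity of f, some \<open>emb (f y)\<close> would lie strictly
  between two different values at r, contradicting monotonicity on whichever side of r the point
  \<open>emb y\<close> lies. Uniqueness makes extension respect identity and composition.\<close>

lemma ext_unique: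
  fixes f :: "'x::{countable, unbounded_dense_linorder} \<Rightarrow> 'x"
  assumes f: "oaut f" and g: "mono g" "\<And>x. g (emb x) = emb (f x)" and h: "mono h" "\<And>x. h (emb x) = emb (f x)"
  shows "g r = h r"
proof -
  have False if "g r < h r" and g: "mono g" "\<And>x. g (emb x) = emb (f x)"
    and h: "mono h" "\<And>x. h (emb x) = emb (f x)" for g h :: "real \<Rightarrow> real"
  proof -
    obtain z :: 'x where z: "g r < emb z" "emb z < h r" using emb_dense[OF \<open>g r < h r\<close>] by blast
    define y where "y = finv f z"
    have "f y = z" using f by (simp add: y_def)
    then have "g r < g (emb y)" "h (emb y) < h r" using z g h by auto
    then show False using monoD[OF g(1), of "emb y" r] monoD[OF h(1), of r "emb y"]
      by (cases "emb y \<le> r") auto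
  qed
  from this[of g h] this[of h g] g h show ?thesis by (meson linorder_neqE)
qed

lemma ext_id: "line_ext (\<lambda>x :: 'x::{countable, unbounded_dense_linorder}. x) r = r"
  by (rule ext_unique[of "\<lambda>x :: 'x. x" _ "\<lambda>r. r"]) (auto intro: ext_mono monoI simp: ext_emb)

lemma ext_comp:
  fixes f g :: "'x::{countable, unbounded_dense_linorder} \<Rightarrow> 'x"
  assumes "oaut f" "oaut g" shows "line_ext (\<lambda>x. f (g x)) r = line_ext f (line_ext g r)"
proof (rule ext_unique[OF oaut_comp[OF assms], where h = "\<lambda>r. line_ext f (line_ext g r)"])
  show "mono (\<lambda>r. line_ext f (line_ext g r))"
    using monoD[OF ext_mono[OF assms(1)]] monoD[OF ext_mono[OF assms(2)]] by (auto intro: monoI)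
qed (use assms in \<open>auto simp: ext_emb oaut_comp intro: ext_mono\<close>)

text \<open>The extensions of f and its inverse are mutually inverse, hence onto, and a monotone map
  onto the line is continuous.\<close>

lemma ext_homeomorphism:
  fixes f :: "'x::{countable, unbounded_dense_linorder} \<Rightarrow> 'x"
  assumes f: "oaut f" shows "homeomorphism UNIV UNIV (line_ext f) (line_ext (finv f))"
proof -
  have inv: "line_ext f (line_ext (finv f) r) = r" "line_ext (finv f) (line_ext f r) = r" for r
    using ext_comp[OF f oaut_inv[OF f], of r] ext_comp[OF oaut_inv[OF f] f, of r] f by (simp_all add: ext_id)
  then have sur: "range (line_ext f) = UNIV" "range (line_ext (finv f)) = UNIV" by (metis surjI)+
  have "continuous_on UNIV (line_ext f)" "continuous_on UNIV (line_ext (finv f))"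
    using monoD[OF ext_mono[OF f]] monoD[OF ext_mono[OF oaut_inv[OF f]]]
    by (auto intro!: continuous_onI_mono simp: sur)
  then show ?thesis using inv sur by (auto simp: homeomorphism_def)
qed

section \<open>The faithful action on the line\<close>

typedef hg = "range (\<lambda>w. {v. eqv RH w v})" by auto

definition clsH :: "hword \<Rightarrow> hg" where "clsH w = Abs_hg {v. eqv RH w v}"

lemma clsH_eq: "clsH u = clsH v \<longleftrightarrow> eqv RH u v"
  unfolding clsH_def by (subst Abs_hg_inject) (auto simp: eqv_classes)

lemma surj_clsH: "surj clsH"
proof (rule surjI)
  fix x
  have "\<exists>w. {v. eqv RH w v} = Rep_hg x" using Rep_hg[of x] by auto
  from someI_ex[OF this] show "clsH (SOME w. {v. eqv RH w v} = Rep_hg x) = x"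
    by (simp add: clsH_def Rep_hg_inverse)
qed

instantiation hg :: linorder
begin
definition less_hg :: "hg \<Rightarrow> hg \<Rightarrow> bool" where
  "less_hg x y \<longleftrightarrow> (\<exists>u v. x = clsH u \<and> y = clsH v \<and> (SOME lt. word_order RH lt) u v)"
definition less_eq_hg :: "hg \<Rightarrow> hg \<Rightarrow> bool" where "less_eq_hg x y \<longleftrightarrow> x = y \<or> x < y"
instance
proof -
  note o = quotient_order[OF someI_ex[OF higman_order] clsH_eq surj_clsH less_hg_def]
  have irrefl: "\<not> x < x" for x :: hg by (rule o(2))
  have trans: "x < y \<Longrightarrow> y < z \<Longrightarrow> x < z" for x y z :: hg by (rule o(3))
  have total: "x \<noteq> y \<Longrightarrow> x < y \<or> y < x" for x y :: hg using o(4) by blast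
  show "OFCLASS(hg, linorder_class)"
    by standard (auto simp: less_eq_hg_def irrefl dest: trans total)
qed
end

lemma hg_action:
  obtains \<theta> :: "4 \<Rightarrow> hg \<Rightarrow> hg" where "oact RH \<theta>" "\<And>w v. act \<theta> w (clsH v) = clsH (w @ v)"
  by (rule quotient_action[OF someI_ex[OF higman_order] clsH_eq surj_clsH
        quotient_order(1)[OF someI_ex[OF higman_order] clsH_eq surj_clsH less_hg_def]]) blast

instance hg :: countable
proof (rule countable_classI[of "\<lambda>x. to_nat (SOME w. clsH w = x)"])
  fix x y :: hg
  have "clsH (SOME w. clsH w = z) = z" for z using surj_clsH by (metis (mono_tags) someI surjD)
  then show "to_nat (SOME w. clsH w = x) = to_nat (SOME w. clsH w = y) \<Longrightarrow> x = y" by (metis to_nat_split)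
qed

lemma higman_class_eq: "higman_class u = higman_class v \<longleftrightarrow> clsH u = clsH v"
  unfolding clsH_eq unfolding higman_class_def higman_eqv_eq RH_def[symmetric] by (rule eqv_classes)

lemma Higman_mult: "higman_class u \<otimes>\<^bsub>Higman\<^esub> higman_class v = higman_class (u @ v)"
proof -
  have "eqv RH (u @ v) w" if "eqv RH u x" "eqv RH v y" "eqv RH (x @ y) w" for x y w
    using eqv_append[OF that(1,2)] that(3) by (rule eqv.trans)
  then show ?thesis unfolding Higman_def higman_class_def higman_eqv_eq RH_def[symmetric]
    by (auto intro: eqv.refl)
qed

theorem theoremA:
  shows "left_orderable Higman \<and>
         (\<exists>\<phi>. \<phi> \<in> hom Higman Homeo_R \<and> inj_on \<phi> (carrier Higman))"
proof -
  obtain \<theta> :: "4 \<Rightarrow> hg \<Rightarrow> hg" where \<theta>: "oact RH \<theta>" "\<And>w v. act \<theta> w (clsH v) = clsH (w @ v)"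
    by (rule hg_action) blast
  define rep where "rep X = (SOME w. higman_class w = X)" for X
  have rep: "clsH (rep (higman_class w)) = clsH w" for w
    unfolding rep_def higman_class_eq[symmetric] by (rule someI[of _ w]) simp
  have car: "carrier Higman = range higman_class" by (simp add: Higman_def)
  have lo: "left_orderable Higman"
    unfolding left_orderable_def
  proof (rule exI[of _ "\<lambda>X Y. clsH (rep X) \<le> clsH (rep Y)"], unfold car, intro conjI ballI impI)
    fix X Y Z assume "X \<in> range higman_class" "Y \<in> range higman_class" "Z \<in> range higman_class"
      and le: "clsH (rep X) \<le> clsH (rep Y)"
    then obtain u v w where [simp]: "X = higman_class u" "Y = higman_class v" "Z = higman_class w" by auto
    have "act \<theta> w (clsH u) \<le> act \<theta> w (clsH v)"
      using le oaut_act[OF \<theta>(1), of w] by (simp add: rep le_less)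
    then show "clsH (rep (Z \<otimes>\<^bsub>Higman\<^esub> X)) \<le> clsH (rep (Z \<otimes>\<^bsub>Higman\<^esub> Y))"
      by (simp add: Higman_mult rep \<theta>(2))
  qed (auto simp: rep simp flip: higman_class_eq)
  \<comment> \<open>The rational fibre, on which the group acts trivially, makes the order dense and
    without endpoints, as the extension to the line requires.\<close>
  define \<Phi> :: "hword \<Rightarrow> (hg, rat) lex \<Rightarrow> (hg, rat) lex" where "\<Phi> w p = Lex (act \<theta> w (lfst p)) (lsnd p)" for w p
  have \<Phi>: "oaut (\<Phi> w)" for w
    by (rule oaut_lexI[OF oaut_act[OF \<theta>(1)] oaut_id(2)]) (simp add: \<Phi>_def)
  define \<phi> where "\<phi> X = line_ext (\<Phi> (rep X))" for X
  have \<Phi>_cong: "\<Phi> u = \<Phi> v" if "clsH u = clsH v" for u v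
    using act_eqv[OF _ \<theta>(1)] that by (auto simp: \<Phi>_def clsH_eq)
  have \<phi>: "\<phi> (higman_class w) = line_ext (\<Phi> w)" for w
    unfolding \<phi>_def using \<Phi>_cong[OF rep] by simp
  have "\<phi> \<in> hom Higman Homeo_R"
  proof (rule homI)
    fix X assume "X \<in> carrier Higman"
    then show "\<phi> X \<in> carrier Homeo_R"
      using ext_homeomorphism[OF \<Phi>, of "rep X"] by (auto simp: Homeo_R_def \<phi>_def)
  next
    fix X Y assume "X \<in> carrier Higman" "Y \<in> carrier Higman"
    then obtain u v where [simp]: "X = higman_class u" "Y = higman_class v" by (auto simp: car)
    have "\<Phi> (u @ v) = (\<lambda>p. \<Phi> u (\<Phi> v p))" by (simp add: \<Phi>_def fun_eq_iff)
    then have "line_ext (\<Phi> (u @ v)) = line_ext (\<Phi> u) \<circ> line_ext (\<Phi> v)"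
      using ext_comp[OF \<Phi>[of u] \<Phi>[of v]] by (auto simp only: comp_def)
    then show "\<phi> (X \<otimes>\<^bsub>Higman\<^esub> Y) = \<phi> X \<otimes>\<^bsub>Homeo_R\<^esub> \<phi> Y"
      by (simp add: Higman_mult \<phi> Homeo_R_def)
  qed
  moreover have "inj_on \<phi> (carrier Higman)"
  proof (rule inj_onI)
    fix X Y assume "X \<in> carrier Higman" "Y \<in> carrier Higman" and eq: "\<phi> X = \<phi> Y"
    then obtain u v where [simp]: "X = higman_class u" "Y = higman_class v" by (auto simp: car)
    \<comment> \<open>The regular action is free, so the orbit of the identity already tells group
      elements apart; the fibre value 0 is arbitrary.\<close>
    let ?p = "Lex (clsH []) 0"
    have "emb (\<Phi> u ?p) = emb (\<Phi> v ?p)"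
      using ext_emb[OF \<Phi>[of u], of ?p] ext_emb[OF \<Phi>[of v], of ?p] eq by (simp add: \<phi>)
    then have "clsH u = clsH v" by (simp add: emb_mono \<Phi>_def \<theta>(2))
    then show "X = Y" by (simp add: higman_class_eq)
  qed
  ultimately show ?thesis using lo by blast
qed

end
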